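(* Let $U\subset\mathbb{C}$ be a domain, let $f_0:U\to\mathbb{C}$ be an analytic function with a Siegel point $z_0\in U$, and let $\{f_n:U\to\mathbb{C}\}_{n\in\mathbb{N}}$ be a sequence of analytic functions each having an attracting fixed point at $z_0$. Suppose that $f_n$ converges to $f_0$ uniformly on each compact subset of $U$ and that the following conditions hold: (i) there is $\Theta<\pi/2$ such that $\big|\arg\big(1-f_n'(z_0)/f_0'(z_0)\big)\big|<\Theta$ for all $n\in\mathbb{N}$; (ii) the functions $\big(f_n(z)-f_0(z)\big)/\big(f_n'(z_0)-f_0'(z_0)\big)$, $n\in\mathbb{N}$, are uniformly bounded on each compact subset of $U$. Then $\mathcal{A}^*(z_0,f_n,U)$ converges to $\mathcal{A}^*(z_0,f_0,U)$ as to the kernel with respect to the point $z_0$ as $n\to\infty$.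
   Context: Here $\mathbb{N}=\{1,2,\dots\}$, and $\arg$ is the principal argument. Iterates. For a domain $U\subset\mathbb{C}$ and an analytic function $f:U\to\mathbb{C}$, the iterates are defined by $f^0=\mathrm{id}_U$, $f^1=f$ and $f^{n+1}:(f^n)^{-1}(U)\to\mathbb{C}$, $f^{n+1}:=f\circ f^n$. Put $E(f,U):=\bigcap_{n\in\mathbb{N}}(f^n)^{-1}(U)$. Fatou and Julia sets. The Fatou set $\mathcal{F}(f,U)$ is the set of all interior points $z$ of $E(f,U)$ such that $\{f^n\}_{n\in\mathbb{N}}$ is a normal family (as maps into the Riemann sphere) in some neighbourhood of $z$. The Julia set is $\mathcal{J}(f,U):=U\setminus\mathcal{F}(f,U)$. Fixed points. Let $z_0\in U$ be a fixed point of $f$ with multiplier $\lambda=f'(z_0)$. It is attracting if $|\lambda|<1$ and neutral if $|\lambda|=1$. If $z_0$ is neutral and no $f^n$, $n\in\mathbb{N}$, is the identity map, then $z_0$ is parabolic if $\lambda=e^{2\pi i\alpha}$ with $\alpha\in\mathbb{Q}$, and irrationally neutral otherwise. An irrationally neutral fixed point that belongs to $\mathcal{F}(f,U)$ is called a Siegel point. Immediate basin. For a fixed point $z_0\in\mathcal{F}(f,U)$, the immediate basin $\mathcal{A}^*(z_0,f,U)$ is the connected component of $\mathcal{F}(f,U)$ containing $z_0$ (the Siegel disk if $z_0$ is a Siegel point). Kernel convergence. For a sequence of domains $A_n\ni z_0$, a domain $A\ni z_0$ is the kernel of $(A_n)$ with respect to $z_0$ if (a) every compact set $K\subset A$ is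 contained in all but finitely many $A_n$, and (b) $A$ is the largest domain containing $z_0$ with property (a). The sequence $A_n$ converges to $A$ as to the kernel with respect to $z_0$ if $A$ is the kernel of every subsequence of $(A_n)$. *)

theory Defs
  imports "HOL-Complex_Analysis.Complex_Analysis"
begin

text \<open>
  An analytic function \<open>f : U \<rightarrow> \<complex>\<close> is represented by a total function whose values
  outside \<open>U\<close> are junk. All notions below depend only on the restriction of \<open>f\<close> to \<open>U\<close>
  (for open \<open>U\<close>).
\<close>

definition plane_domain :: "complex set \<Rightarrow> bool" where
  "plane_domain U \<longleftrightarrow> open U \<and> connected U \<and> U \<noteq> {}"


subsection \<open>Iterates\<close>

text \<open>
  \<open>iter_dom f U n\<close> is the domain of definition of the \<open>n\<close>-th iterate of \<open>f : U \<rightarrow> \<complex>\<close>;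
  on this set the iterate agrees with \<open>f ^^ n\<close>.
\<close>

fun iter_dom :: "(complex \<Rightarrow> complex) \<Rightarrow> complex set \<Rightarrow> nat \<Rightarrow> complex set" where
  "iter_dom f U 0 = U"
| "iter_dom f U (Suc n) = {z \<in> iter_dom f U n. (f ^^ n) z \<in> U}"

definition iter_set :: "(complex \<Rightarrow> complex) \<Rightarrow> complex set \<Rightarrow> complex set" where
  "iter_set f U = (\<Inter>n\<in>{1..}. {z \<in> iter_dom f U n. (f ^^ n) z \<in> U})"


subsection \<open>Normal families and the Fatou set\<close>

text \<open>
  The Riemann sphere is the unit sphere of \<open>\<complex> \<times> \<real>\<close> with the induced (chordal) metric,
  and \<open>\<complex>\<close> is embedded by inverse stereographic projection; \<open>\<infinity>\<close> is the pole \<open>(0, 1)\<close>.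
\<close>

abbreviation riemann_sphere :: "(complex \<times> real) set" where
  "riemann_sphere \<equiv> sphere 0 1"

definition to_sphere :: "complex \<Rightarrow> complex \<times> real" where
  "to_sphere z =
     (2 * z / of_real (1 + (norm z)\<^sup>2), ((norm z)\<^sup>2 - 1) / ((norm z)\<^sup>2 + 1))"

lemma to_sphere_in_riemann_sphere: "to_sphere z \<in> riemann_sphere"
proof -
  define t where "t = (norm z)\<^sup>2"
  have t: "1 + t > 0" unfolding t_def by (simp add: add_pos_nonneg)
  have n: "norm (2 * z / of_real (1 + t)) = 2 * norm z / (1 + t)"
    using t by (simp add: norm_divide norm_mult del: of_real_add)
  have "(2 * norm z / (1 + t))\<^sup>2 + ((t - 1) / (t + 1))\<^sup>2 = (4 * t + (t - 1)\<^sup>2) / (1 + t)\<^sup>2"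
    by (simp add: t_def power_divide power_mult_distrib add_divide_distrib add.commute)
  also have "4 * t + (t - 1)\<^sup>2 = (1 + t)\<^sup>2"
    by (simp add: power2_eq_square algebra_simps)
  also have "(1 + t)\<^sup>2 / (1 + t)\<^sup>2 = 1" using t by simp
  finally show ?thesis
    using n by (simp add: to_sphere_def norm_prod_def power_divide flip: t_def)
qed

text \<open>
  Normality in an open set \<open>W\<close>; the limits are allowed to take the value \<open>\<infinity>\<close>.
\<close>

definition normal_family :: "(complex \<Rightarrow> complex) set \<Rightarrow> complex set \<Rightarrow> bool" where
  "normal_family F W \<longleftrightarrow>
     (\<forall>h :: nat \<Rightarrow> complex \<Rightarrow> complex. range h \<subseteq> F \<longrightarrow>
        (\<exists>r g. strict_mono (r :: nat \<Rightarrow> nat) \<and> g ` W \<subseteq> riemann_sphere \<and>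
           (\<forall>K. compact K \<and> K \<subseteq> W \<longrightarrow>
              uniform_limit K (\<lambda>k z. to_sphere (h (r k) z)) g sequentially)))"

definition fatou_set :: "(complex \<Rightarrow> complex) \<Rightarrow> complex set \<Rightarrow> complex set" where
  "fatou_set f U =
     {z \<in> interior (iter_set f U).
        \<exists>W. open W \<and> z \<in> W \<and> W \<subseteq> iter_set f U \<and> normal_family {f ^^ n | n. 1 \<le> n} W}"


subsection \<open>Fixed points\<close>

definition attracting_fixpoint :: "(complex \<Rightarrow> complex) \<Rightarrow> complex set \<Rightarrow> complex \<Rightarrow> bool" where
  "attracting_fixpoint f U z0 \<longleftrightarrow> z0 \<in> U \<and> f z0 = z0 \<and> norm (deriv f z0) < 1"

definition neutral_fixpoint :: "(complex \<Rightarrow> complex) \<Rightarrow> complex set \<Rightarrow> complex \<Rightarrow> bool" where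
  "neutral_fixpoint f U z0 \<longleftrightarrow> z0 \<in> U \<and> f z0 = z0 \<and> norm (deriv f z0) = 1"

definition irrationally_neutral_fixpoint ::
  "(complex \<Rightarrow> complex) \<Rightarrow> complex set \<Rightarrow> complex \<Rightarrow> bool" where
  "irrationally_neutral_fixpoint f U z0 \<longleftrightarrow>
     neutral_fixpoint f U z0 \<and>
     (\<forall>n\<ge>1. \<not> (\<forall>z\<in>iter_dom f U n. (f ^^ n) z = z)) \<and>
     \<not> (\<exists>\<alpha>::real. \<alpha> \<in> \<rat> \<and> deriv f z0 = exp (2 * of_real pi * \<i> * of_real \<alpha>))"

definition siegel_point :: "(complex \<Rightarrow> complex) \<Rightarrow> complex set \<Rightarrow> complex \<Rightarrow> bool" where
  "siegel_point f U z0 \<longleftrightarrow> irrationally_neutral_fixpoint f U z0 \<and> z0 \<in> fatou_set f U"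

definition immediate_basin ::
  "complex \<Rightarrow> (complex \<Rightarrow> complex) \<Rightarrow> complex set \<Rightarrow> complex set" where
  "immediate_basin z0 f U = connected_component_set (fatou_set f U) z0"


subsection \<open>Kernel convergence\<close>

definition eventually_covers_compacts :: "(nat \<Rightarrow> complex set) \<Rightarrow> complex set \<Rightarrow> bool" where
  "eventually_covers_compacts A B \<longleftrightarrow>
     (\<forall>K. compact K \<and> K \<subseteq> B \<longrightarrow> (\<forall>\<^sub>F n in sequentially. K \<subseteq> A n))"

definition is_kernel :: "complex \<Rightarrow> (nat \<Rightarrow> complex set) \<Rightarrow> complex set \<Rightarrow> bool" where
  "is_kernel z0 A B \<longleftrightarrow>
     plane_domain B \<and> z0 \<in> B \<and> eventually_covers_compacts A B \<and>
     (\<forall>C. plane_domain C \<and> z0 \<in> C \<and> eventually_covers_compacts A C \<longrightarrow> C \<subseteq> B)"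

definition kernel_converges :: "complex \<Rightarrow> (nat \<Rightarrow> complex set) \<Rightarrow> complex set \<Rightarrow> bool" where
  "kernel_converges z0 A B \<longleftrightarrow>
     (\<forall>n. plane_domain (A n) \<and> z0 \<in> A n) \<and>
     (\<forall>r. strict_mono (r :: nat \<Rightarrow> nat) \<longrightarrow> is_kernel z0 (A \<circ> r) B)"

end

theory Submission
  imports Defs
begin

text \<open>
  The kernel property has two halves: the basins \<open>A\<^sub>n\<close> of the \<open>f\<^sub>n\<close> eventually swallow every compact
  subset of the Siegel disk \<open>A\<^sub>0\<close>, and no larger domain has this property.
  
  For the first half (\<open>perturbation_basin_covers\<close>) the dynamics on \<open>A\<^sub>0\<close> is conjugated to the rotation
  \<open>w \<mapsto> \<rho> w\<close> of a disk or of the plane, where \<open>\<rho> = f\<^sub>0'(z\<^sub>0)\<close>. In that coordinate \<open>f\<^sub>n\<close> becomes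
  \<open>w \<mapsto> \<rho> w + \<epsilon>\<^sub>n H\<^sub>n(w)\<close> with \<open>\<epsilon>\<^sub>n = f\<^sub>n'(z\<^sub>0) - \<rho> \<rightarrow> 0\<close>; condition (ii) makes the \<open>H\<^sub>n\<close> uniformly bounded, and
  \<open>H\<^sub>n(0) = 0\<close>, \<open>H\<^sub>n'(0) = 1\<close>. After \<open>N\<close> steps the perturbation contributes, to first order in \<open>\<epsilon>\<^sub>n\<close>, the
  sum of \<open>\<rho>\<^sup>-\<^sup>j H\<^sub>n(\<rho>\<^sup>j w)\<close> over \<open>j < N\<close>, and as \<open>\<rho>\<close> is not a root of unity the average of these terms
  over \<open>j\<close> singles out the linear part of \<open>H\<^sub>n\<close>, uniformly over all functions with the same bound
  (\<open>rotation_averages_converge\<close>). So up to small errors the \<open>N\<close>-th iterate is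
  \<open>\<rho>\<^sup>N (1 + N \<epsilon>\<^sub>n / \<rho>) w\<close>, and condition (i) keeps \<open>- \<epsilon>\<^sub>n / \<rho>\<close> in a sector around the positive axis, so that
  this map shrinks a given disk into itself once \<open>\<epsilon>\<^sub>n\<close> is small (\<open>perturbed_rotation_preserves_disc\<close>). The
  \<open>f\<^sub>n\<close>-orbits of the preimage of that disk stay in a compact set, which puts it into \<open>A\<^sub>n\<close>.
  
  The conjugacy (\<open>rotation_domain.linearization\<close>) is built from averages over orbits. Averaging \<open>\<rho>\<^sup>-\<^sup>k (f\<^sub>0\<^sup>k - z\<^sub>0)\<close> over \<open>k\<close> gives an eigenfunction \<open>\<phi>\<close> on
  \<open>A\<^sub>0\<close> with \<open>\<phi> \<circ> f\<^sub>0 = \<rho> \<phi>\<close>. If \<open>z\<^sub>0 + \<Sum> b\<^sub>j w\<^sup>j\<close> is the local inverse of \<open>\<phi>\<close>, then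
  \<open>b\<^sub>j \<phi>\<^sup>j\<close> is a limit of averages of \<open>\<rho>\<^sup>-\<^sup>j\<^sup>k (f\<^sub>0\<^sup>k - z\<^sub>0)\<close>, hence at every point of \<open>A\<^sub>0\<close> is bounded by the
  size of the orbit. Therefore the power series converges on all of \<open>\<phi>(A\<^sub>0)\<close> and inverts \<open>\<phi>\<close> globally.
  
  For the second half (\<open>kernel_subset_fatou_set\<close>) let \<open>C\<close> be a domain around \<open>z\<^sub>0\<close> whose compact subsets are
  eventually covered by the \<open>A\<^sub>n\<close>. By Hurwitz' theorem all \<open>f\<^sub>0\<^sup>k\<close> map \<open>C\<close> into \<open>U\<close>. An attracting basin
  contains no periodic point but \<open>z\<^sub>0\<close>, so Hurwitz again shows that \<open>f\<^sub>0\<^sup>k(z)\<close>, \<open>k \<ge> 2\<close>, is distinct from \<open>z\<close> and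
  from \<open>f\<^sub>0(z)\<close> whenever \<open>f\<^sub>0(z) \<noteq> z\<^sub>0\<close>. The functions \<open>(f\<^sub>0\<^sup>k(z) - z) / (f\<^sub>0(z) - z)\<close> therefore omit \<open>0\<close> and \<open>1\<close>,
  and Montel's theorem bounds them, since they are bounded at one point near \<open>z\<^sub>0\<close>. Near the remaining
  points, those with \<open>f\<^sub>0(z) = z\<^sub>0\<close>, boundedness is inherited from the Siegel disk.
  
  Throughout, normality is replaced by boundedness on compact sets: on a component of the
  Fatou set that contains a fixed point, the two are equivalent (\<open>immediate_basin_bounded\<close>,
  \<open>bounded_imp_subset_fatou_set\<close>).
\<close>

section \<open>Iterates and normal families\<close>

lemma iter_dom_iff: "z \<in> iter_dom f U n \<longleftrightarrow> z \<in> U \<and> (\<forall>k<n. (f ^^ k) z \<in> U)"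
  by (induction n) (auto simp: less_Suc_eq)

lemma iter_set_iff: "z \<in> iter_set f U \<longleftrightarrow> (\<forall>n. (f ^^ n) z \<in> U)"
proof
  assume *: "z \<in> iter_set f U"
  show "\<forall>n. (f ^^ n) z \<in> U"
  proof
    fix n
    have "(\<Inter>n\<in>{1..}. {z \<in> iter_dom f U n. (f ^^ n) z \<in> U}) \<subseteq>
        {z \<in> iter_dom f U (Suc n). (f ^^ Suc n) z \<in> U}"
      by (rule INT_lower) simp
    then have "z \<in> iter_dom f U (Suc n)"
      using * unfolding iter_set_def by blast
    then show "(f ^^ n) z \<in> U"
      by (auto simp: iter_dom_iff)
  qed
next
  assume *: "\<forall>n. (f ^^ n) z \<in> U"
  then have "z \<in> U"
    by (metis funpow_0)
  with * show "z \<in> iter_set f U"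
    by (auto simp: iter_set_def iter_dom_iff)
qed

lemma holomorphic_iterate:
  assumes "f holomorphic_on U" "\<And>z k. z \<in> W \<Longrightarrow> k < n \<Longrightarrow> (f ^^ k) z \<in> U"
  shows "(f ^^ n) holomorphic_on W"
  using assms(2)
proof (induction n)
  case 0
  then show ?case by (simp add: id_def)
next
  case (Suc n)
  have "(f \<circ> (f ^^ n)) holomorphic_on W"
    using Suc by (intro holomorphic_on_compose_gen[OF _ assms(1)] Suc.IH) auto
  then show ?case by (simp add: o_def)
qed

lemma iterate_fixpoint: "f z = z \<Longrightarrow> (f ^^ n) z = z"
  by (induction n) auto

definition bounded_on_compacts :: "(complex \<Rightarrow> complex) set \<Rightarrow> complex set \<Rightarrow> bool" where
  "bounded_on_compacts F A \<longleftrightarrow>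
     (\<forall>K. compact K \<longrightarrow> K \<subseteq> A \<longrightarrow> (\<exists>B. \<forall>h\<in>F. \<forall>z\<in>K. norm (h z) \<le> B))"

lemma bounded_on_compactsI:
  assumes "\<And>z. z \<in> A \<Longrightarrow> \<exists>e>0. \<exists>B. \<forall>h\<in>F. \<forall>y\<in>ball z e \<inter> A. norm (h y) \<le> B"
  shows "bounded_on_compacts F A"
  unfolding bounded_on_compacts_def
proof (intro allI impI)
  fix K assume K: "compact K" "K \<subseteq> A"
  obtain e B where eB: "\<And>z. z \<in> A \<Longrightarrow> e z > 0 \<and> (\<forall>h\<in>F. \<forall>y\<in>ball z (e z) \<inter> A. norm (h y) \<le> (B z :: real))"
    using assms by metis
  have "K \<subseteq> (\<Union>z\<in>K. ball z (e z))"
    using K(2) eB by (auto intro!: centre_in_ball[THEN iffD2])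
  then obtain D where D: "D \<subseteq> K" "finite D" "K \<subseteq> (\<Union>z\<in>D. ball z (e z))"
    using compactE_image[OF K(1), of K "\<lambda>z. ball z (e z)"] by auto
  have "norm (h y) \<le> (\<Sum>z\<in>D. \<bar>B z\<bar>)" if "h \<in> F" "y \<in> K" for h y
  proof -
    obtain z where z: "z \<in> D" "y \<in> ball z (e z)"
      using D(3) \<open>y \<in> K\<close> by blast
    have "norm (h y) \<le> \<bar>B z\<bar>"
    proof -
      have "z \<in> A" "y \<in> A" using z D K that by auto
      then have "norm (h y) \<le> B z" using eB[of z] z that by blast
      then show ?thesis by simp
    qed
    also have "\<dots> \<le> (\<Sum>z\<in>D. \<bar>B z\<bar>)"
      using z D by (intro member_le_sum) auto
    finally show ?thesis .
  qed
  then show "\<exists>B. \<forall>h\<in>F. \<forall>z\<in>K. norm (h z) \<le> B" by blast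
qed

lemma bounded_on_compacts_subset:
  assumes "bounded_on_compacts F A" "G \<subseteq> F" "B \<subseteq> A"
  shows "bounded_on_compacts G B"
  unfolding bounded_on_compacts_def
proof (intro allI impI)
  fix K assume "compact K" "K \<subseteq> B"
  then obtain M where "\<forall>h\<in>F. \<forall>z\<in>K. norm (h z) \<le> M"
    using assms unfolding bounded_on_compacts_def by (meson order_trans)
  then show "\<exists>M. \<forall>h\<in>G. \<forall>z\<in>K. norm (h z) \<le> M"
    using assms(2) by (intro exI[of _ M]) auto
qed

lemma bounded_on_compactsE:
  assumes "bounded_on_compacts F A" "compact K" "K \<subseteq> A"
  obtains B where "B > 0" "\<And>h z. h \<in> F \<Longrightarrow> z \<in> K \<Longrightarrow> norm (h z) \<le> B"
proof -
  obtain B where B: "\<And>h z. h \<in> F \<Longrightarrow> z \<in> K \<Longrightarrow> norm (h z) \<le> B"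
    using assms(1)[unfolded bounded_on_compacts_def, rule_format, OF assms(2,3)] by blast
  show thesis
  proof (rule that)
    show "\<bar>B\<bar> + 1 > 0" by simp
    show "norm (h z) \<le> \<bar>B\<bar> + 1" if "h \<in> F" "z \<in> K" for h z
      using B[OF that] by linarith
  qed
qed

lemma continuous_to_sphere: "continuous_on A to_sphere"
proof -
  have "1 + (norm z)\<^sup>2 \<noteq> 0" "complex_of_real (1 + (norm z)\<^sup>2) \<noteq> 0" for z :: complex
    by (metis add_pos_nonneg less_irrefl of_real_eq_0_iff zero_le_power2 zero_less_one)+
  then show ?thesis
    unfolding to_sphere_def
    by (intro continuous_intros) (auto simp: add.commute)
qed

text \<open>
  Montel's theorem for a sequence, in the form in which limits of iterates and of averages are extracted
  below.
\<close>

lemma Montel_subsequence: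
  fixes h :: "nat \<Rightarrow> complex \<Rightarrow> complex"
  assumes "open W" "\<And>n. h n holomorphic_on W" "bounded_on_compacts (range h) W"
  obtains g r where "g holomorphic_on W" "strict_mono (r :: nat \<Rightarrow> nat)"
    "\<And>x. x \<in> W \<Longrightarrow> (\<lambda>n. h (r n) x) \<longlonglongrightarrow> g x"
    "\<And>K. compact K \<Longrightarrow> K \<subseteq> W \<Longrightarrow> uniform_limit K (\<lambda>n. h (r n)) g sequentially"
proof (rule Montel[OF assms(1), of "range h" h])
  show "\<exists>B. \<forall>h\<in>range h. \<forall>z\<in>K. norm (h z) \<le> B" if "compact K" "K \<subseteq> W" for K
    using assms(3)[unfolded bounded_on_compacts_def, rule_format, OF that] .
  fix g and r :: "nat \<Rightarrow> nat"
  assume "g holomorphic_on W" "strict_mono r"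
    "\<And>x. x \<in> W \<Longrightarrow> (\<lambda>n. h (r n) x) \<longlonglongrightarrow> g x"
    "\<And>K. compact K \<Longrightarrow> K \<subseteq> W \<Longrightarrow> uniform_limit K (h \<circ> r) g sequentially"
  then show thesis
    by (intro that[of g r]) (auto simp: o_def)
qed (use assms(2) in auto)

text \<open>
  Locally uniform convergence in the plane implies spherical convergence because \<open>to_sphere\<close> is uniformly
  continuous on the closed disks that contain all the values on a given compact set.
\<close>

lemma bounded_imp_normal_family:
  assumes "open W" "\<And>h. h \<in> F \<Longrightarrow> h holomorphic_on W" "bounded_on_compacts F W"
  shows "normal_family F W"
  unfolding normal_family_def
proof (intro allI impI)
  fix h :: "nat \<Rightarrow> complex \<Rightarrow> complex" assume h: "range h \<subseteq> F"
  have "\<And>n. h n holomorphic_on W" "bounded_on_compacts (range h) W"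
    using assms(2) h bounded_on_compacts_subset[OF assms(3) h order.refl] by auto
  then obtain g r where g: "strict_mono (r :: nat \<Rightarrow> nat)"
      "\<And>x. x \<in> W \<Longrightarrow> (\<lambda>n. h (r n) x) \<longlonglongrightarrow> g x"
      "\<And>K. compact K \<Longrightarrow> K \<subseteq> W \<Longrightarrow> uniform_limit K (\<lambda>n. h (r n)) g sequentially"
    using Montel_subsequence[OF assms(1)] by metis
  have lim: "uniform_limit K (\<lambda>k z. to_sphere (h (r k) z)) (to_sphere \<circ> g) sequentially"
    if K: "compact K" "K \<subseteq> W" for K
  proof -
    obtain B where B: "\<And>h z. h \<in> F \<Longrightarrow> z \<in> K \<Longrightarrow> norm (h z) \<le> B"
      using bounded_on_compactsE[OF assms(3) K] by metis
    have hB: "norm (h n z) \<le> B" if "z \<in> K" for n z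
      using B[of "h n" z] h that by (simp add: subset_iff)
    have "uniform_limit K (\<lambda>k z. to_sphere (h (r k) z)) (to_sphere \<circ> g) sequentially"
    proof (rule uniform_limit_compose[OF g(3)[OF K], where U = "cball 0 B"])
      show "uniformly_continuous_on (cball 0 B) to_sphere"
        by (intro compact_uniformly_continuous continuous_to_sphere) auto
      show "\<forall>\<^sub>F n in sequentially. h (r n) ` K \<subseteq> cball 0 B"
        using hB by (auto intro!: always_eventually)
      show "g ` K \<subseteq> cball 0 B"
      proof clarsimp
        fix z assume "z \<in> K"
        then show "norm (g z) \<le> B"
          using K hB by (intro Lim_norm_ubound[OF _ g(2)]) auto
      qed
    qed
    then show ?thesis by simp
  qed
  have sph: "(to_sphere \<circ> g) ` W \<subseteq> riemann_sphere"
    using to_sphere_in_riemann_sphere by auto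
  show "\<exists>r g. strict_mono (r :: nat \<Rightarrow> nat) \<and> g ` W \<subseteq> riemann_sphere \<and>
     (\<forall>K. compact K \<and> K \<subseteq> W \<longrightarrow>
        uniform_limit K (\<lambda>k z. to_sphere (h (r k) z)) g sequentially)"
    by (rule exI[of _ r], rule exI[of _ "to_sphere \<circ> g"]) (use g(1) lim sph in blast)
qed

lemma normal_family_subset:
  assumes "normal_family F W" "V \<subseteq> W"
  shows "normal_family F V"
  unfolding normal_family_def
proof (intro allI impI)
  fix h :: "nat \<Rightarrow> complex \<Rightarrow> complex" assume h: "range h \<subseteq> F"
  obtain r g where rg: "strict_mono (r :: nat \<Rightarrow> nat) \<and> g ` W \<subseteq> riemann_sphere \<and>
     (\<forall>K. compact K \<and> K \<subseteq> W \<longrightarrow>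
        uniform_limit K (\<lambda>k z. to_sphere (h (r k) z)) g sequentially)"
    using assms(1)[unfolded normal_family_def, rule_format, OF h] by (elim exE) (rule that)
  have "g ` V \<subseteq> riemann_sphere"
    using rg assms(2) by (meson image_mono order_trans)
  moreover have "uniform_limit K (\<lambda>k z. to_sphere (h (r k) z)) g sequentially"
    if "compact K \<and> K \<subseteq> V" for K
    using rg that assms(2) by (meson order_trans)
  ultimately show "\<exists>r g. strict_mono (r :: nat \<Rightarrow> nat) \<and> g ` V \<subseteq> riemann_sphere \<and>
     (\<forall>K. compact K \<and> K \<subseteq> V \<longrightarrow>
        uniform_limit K (\<lambda>k z. to_sphere (h (r k) z)) g sequentially)"
    using rg by (intro exI[of _ r] exI[of _ g] conjI allI impI) simp_all
qed

text \<open>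
  On the sphere \<open>z \<mapsto> 1/z\<close> is a rotation, so \<open>1/z\<close> is a continuous function of the spherical point also
  near \<open>\<infinity>\<close>. This turns spherical convergence near a pole into ordinary uniform convergence of the
  reciprocals.
\<close>

lemma inverse_from_sphere:
  assumes "z \<noteq> 0"
  shows "cnj (fst (to_sphere z)) / of_real (1 + snd (to_sphere z)) = inverse z"
proof -
  define t where "t = (norm z)\<^sup>2"
  have t: "t > 0" unfolding t_def using assms by simp
  have zz: "z * cnj z = of_real t"
    by (simp add: t_def complex_mult_cnj cmod_power2)
  have 1: "1 + (t - 1) / (t + 1) = 2 * t / (1 + t)"
    using t by (simp add: field_simps)
  have "cnj (fst (to_sphere z)) / of_real (1 + snd (to_sphere z))
      = (2 * cnj z / of_real (1 + t)) / of_real (2 * t / (1 + t))"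
    unfolding to_sphere_def t_def[symmetric] fst_conv snd_conv 1 by simp
  also have "\<dots> = cnj z / of_real t"
    using t by (simp add: field_simps del: of_real_add)
  also have "\<dots> = inverse z"
    using zz assms t by (simp add: field_simps)
  finally show ?thesis .
qed

lemma riemann_sphere_pole_iff:
  fixes p :: "complex \<times> real"
  assumes "p \<in> riemann_sphere" "snd p > 0"
  shows "fst p = 0 \<longleftrightarrow> snd p = 1"
proof -
  have "(norm (fst p))\<^sup>2 + (snd p)\<^sup>2 = 1"
    using assms(1) by (simp add: norm_prod_def real_sqrt_eq_1_iff)
  then show ?thesis
    using assms(2) by (auto simp: power2_eq_1_iff)
qed

text \<open>
  Near a point where the spherical limit \<open>g\<close> is \<open>\<infinity>\<close> the reciprocals of the \<open>h n\<close> are eventually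
  holomorphic without zeros and converge uniformly, so by Hurwitz their limit, which has a zero, is
  identically \<open>0\<close>: the limit is \<open>\<infinity>\<close> on a whole neighbourhood.
\<close>

lemma normal_family_limit_infinite_open:
  assumes W: "open W" and hol: "\<And>n. h n holomorphic_on W"
    and g: "g ` W \<subseteq> riemann_sphere"
    and lim: "\<And>K. compact K \<Longrightarrow> K \<subseteq> W \<Longrightarrow>
           uniform_limit K (\<lambda>k z. to_sphere (h k z)) g sequentially"
    and cont: "continuous_on W g"
  shows "open {z \<in> W. snd (g z) = 1}"
proof (rule Topological_Spaces.openI)
  fix z1 assume "z1 \<in> {z \<in> W. snd (g z) = 1}"
  then have z1: "z1 \<in> W" "snd (g z1) = 1" by auto
  have "continuous_on W (\<lambda>z. snd (g z))"
    by (intro continuous_intros cont)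
  then have "open (W \<inter> (\<lambda>z. snd (g z)) -` {3/4<..})"
    by (intro continuous_open_preimage W) auto
  moreover have "z1 \<in> W \<inter> (\<lambda>z. snd (g z)) -` {3/4<..}"
    using z1 by auto
  ultimately obtain e where e: "e > 0" "cball z1 e \<subseteq> W \<inter> (\<lambda>z. snd (g z)) -` {3/4<..}"
    by (metis open_contains_cball)
  then have eW: "cball z1 e \<subseteq> W" and eg: "\<And>z. z \<in> cball z1 e \<Longrightarrow> snd (g z) > 3/4"
    by auto
  have "\<forall>\<^sub>F k in sequentially. \<forall>z\<in>cball z1 e. dist (to_sphere (h k z)) (g z) < 1/4"
    using uniform_limitD[OF lim[OF compact_cball eW], of "1/4"] by simp
  then obtain k0 where k0: "\<And>k z. k \<ge> k0 \<Longrightarrow> z \<in> cball z1 e \<Longrightarrow> dist (to_sphere (h k z)) (g z) < 1/4"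
    unfolding eventually_sequentially by blast
  have snd_h: "snd (to_sphere (h k z)) > 1/2" if "k \<ge> k0" "z \<in> cball z1 e" for k z
    using k0[OF that] eg[OF that(2)] dist_snd_le[of "to_sphere (h k z)" "g z"]
    by (simp add: dist_real_def)
  have h_nz: "h k z \<noteq> 0" if "k \<ge> k0" "z \<in> cball z1 e" for k z
  proof
    assume "h k z = 0"
    then show False using snd_h[OF that] by (simp add: to_sphere_def)
  qed
  \<comment> \<open>\<open>q\<close> recovers \<open>1/z\<close> from the spherical point of \<open>z\<close>; \<open>S\<close> is a neighbourhood of \<open>\<infinity>\<close> on which it is uniformly continuous.\<close>
  define q :: "complex \<times> real \<Rightarrow> complex" where
    "q = (\<lambda>p. cnj (fst p) / of_real (1 + snd p))"
  define S where "S = (cball 0 1 :: (complex \<times> real) set) \<inter> {p. snd p \<ge> 1/2}"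
  have "closed {p :: complex \<times> real. snd p \<ge> 1/2}"
    by (intro closed_Collect_le continuous_intros)
  then have "compact S"
    unfolding S_def by (intro compact_Int_closed) auto
  moreover have "continuous_on S q"
    unfolding q_def S_def
  proof (intro continuous_intros ballI)
    fix p :: "complex \<times> real" assume "p \<in> cball 0 1 \<inter> {p. 1 / 2 \<le> snd p}"
    then have "1 + snd p \<noteq> 0" by auto
    then show "complex_of_real (1 + snd p) \<noteq> 0"
      by (metis of_real_eq_0_iff)
  qed
  ultimately have q: "uniformly_continuous_on S q"
    by (rule compact_uniformly_continuous[rotated])
  define H where "H k = (\<lambda>z. inverse (h (k + k0) z))" for k
  have Hhol: "H k holomorphic_on ball z1 e" for k
    unfolding H_def using h_nz eW
    by (intro holomorphic_intros holomorphic_on_subset[OF hol]) auto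
  have Hlim: "uniform_limit K H (q \<circ> g) sequentially" if K: "compact K" "K \<subseteq> ball z1 e" for K
  proof -
    have "K \<subseteq> cball z1 e" using K(2) ball_subset_cball by (rule order_trans)
    then have "K \<subseteq> W" using eW by (rule order_trans)
    have "uniform_limit K (\<lambda>k z. to_sphere (h (k + k0) z)) g sequentially"
      by (rule filterlim_compose[OF lim[OF K(1) \<open>K \<subseteq> W\<close>] filterlim_add_const_nat_at_top])
    then have "uniform_limit K (\<lambda>k z. q (to_sphere (h (k + k0) z))) (q \<circ> g) sequentially"
    proof (rule uniform_limit_compose[OF _ q])
      show "\<forall>\<^sub>F n in sequentially. (\<lambda>z. to_sphere (h (n + k0) z)) ` K \<subseteq> S"
      proof (intro always_eventually allI image_subsetI)
        fix n z assume "z \<in> K"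
        then have "snd (to_sphere (h (n + k0) z)) > 1/2"
          using \<open>K \<subseteq> cball z1 e\<close> by (intro snd_h) auto
        then show "to_sphere (h (n + k0) z) \<in> S"
          using to_sphere_in_riemann_sphere[of "h (n + k0) z"] by (auto simp: S_def)
      qed
      show "g ` K \<subseteq> S"
      proof (intro image_subsetI)
        fix z assume "z \<in> K"
        then have "z \<in> W" "snd (g z) > 3/4" using eg[of z] \<open>K \<subseteq> W\<close> \<open>K \<subseteq> cball z1 e\<close> by blast+
        then show "g z \<in> S" using g by (fastforce simp: S_def)
      qed
    qed
    moreover have "q (to_sphere (h (k + k0) z)) = H k z" if "z \<in> K" for k z
      unfolding q_def H_def using that \<open>K \<subseteq> cball z1 e\<close> by (intro inverse_from_sphere h_nz) auto
    ultimately show ?thesis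
      by (subst uniform_limit_cong'[where g = "\<lambda>k z. q (to_sphere (h (k + k0) z))" and i = "q \<circ> g"]) auto
  qed
  have Ghol: "(q \<circ> g) holomorphic_on ball z1 e"
  proof (rule holomorphic_uniform_sequence[OF _ Hhol])
    fix x assume "x \<in> ball z1 e"
    then obtain d where "d > 0" "cball x d \<subseteq> ball z1 e"
      by (metis open_ball open_contains_cball)
    then show "\<exists>d>0. cball x d \<subseteq> ball z1 e \<and> uniform_limit (cball x d) H (q \<circ> g) sequentially"
      using Hlim[of "cball x d"] by auto
  qed auto
  have g_z: "fst (g z) = 0 \<longleftrightarrow> snd (g z) = 1" if "z \<in> cball z1 e" for z
  proof (rule riemann_sphere_pole_iff)
    show "g z \<in> riemann_sphere" using eW that g by blast
    show "snd (g z) > 0" using eg[OF that] by linarith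
  qed
  have G0: "(q \<circ> g) z1 = 0"
    using g_z[of z1] e(1) z1 by (simp add: q_def)
  have "(q \<circ> g) constant_on ball z1 e"
  proof (rule ccontr)
    assume nc: "\<not> (q \<circ> g) constant_on ball z1 e"
    have "(q \<circ> g) z1 \<noteq> 0"
    proof (rule Hurwitz_no_zeros[of "ball z1 e" H "q \<circ> g"])
      show "H n z \<noteq> 0" if "z \<in> ball z1 e" for n z
        using h_nz[of "n + k0" z] that by (simp add: H_def)
      show "uniform_limit K H (q \<circ> g) sequentially" if "compact K" "K \<subseteq> ball z1 e" for K
        using Hlim that .
    qed (use e Hhol Ghol nc in auto)
    with G0 show False by simp
  qed
  then have "(q \<circ> g) z = 0" if "z \<in> ball z1 e" for z
    using G0 that e(1) unfolding constant_on_def by (metis centre_in_ball)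
  then have "snd (g z) = 1" if "z \<in> ball z1 e" for z
    using g_z[of z] eg[of z] that by (fastforce simp: q_def simp flip: of_real_add)
  then show "\<exists>T. open T \<and> z1 \<in> T \<and> T \<subseteq> {z \<in> W. snd (g z) = 1}"
    using e(1) eW by (intro exI[of _ "ball z1 e"]) auto
qed

section \<open>Fatou components of a fixed point\<close>

text \<open>
  The points where a subsequential spherical limit is infinite form an open and closed set, so on a
  connected set a single point with bounded values excludes the value \<open>\<infinity>\<close> altogether. If the family
  were unbounded on a compact set, however, the limit along suitable points would be infinite.
\<close>

lemma normal_family_bounded:
  assumes W: "open W" "connected W" and hol: "\<And>h. h \<in> F \<Longrightarrow> h holomorphic_on W"
    and normal: "normal_family F W" and p: "p \<in> W" "\<And>h. h \<in> F \<Longrightarrow> norm (h p) \<le> C"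
  shows "bounded_on_compacts F W"
  unfolding bounded_on_compacts_def
proof (intro allI impI, rule ccontr)
  fix K assume K: "compact K" "K \<subseteq> W" and unb: "\<nexists>B. \<forall>h\<in>F. \<forall>z\<in>K. norm (h z) \<le> B"
  have "\<exists>h z. h \<in> F \<and> z \<in> K \<and> norm (h z) > real n" for n :: nat
    using unb by (meson not_le)
  then obtain h z where hz: "\<And>n. h n \<in> F" "\<And>n. z n \<in> K" "\<And>n. norm (h n (z n)) > real n"
    by metis
  have "range h \<subseteq> F" using hz by auto
  then obtain r g where rg: "strict_mono (r :: nat \<Rightarrow> nat) \<and> g ` W \<subseteq> riemann_sphere \<and>
     (\<forall>K. compact K \<and> K \<subseteq> W \<longrightarrow>
        uniform_limit K (\<lambda>k z. to_sphere (h (r k) z)) g sequentially)"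
    using normal[unfolded normal_family_def, rule_format, OF \<open>range h \<subseteq> F\<close>] by (elim exE) (rule that)
  then have r: "strict_mono r" and g: "g ` W \<subseteq> riemann_sphere"
    and lim: "\<And>K. compact K \<Longrightarrow> K \<subseteq> W \<Longrightarrow>
        uniform_limit K (\<lambda>k z. to_sphere (h (r k) z)) g sequentially"
    by simp_all
  have cont: "continuous_on W g"
  proof (subst continuous_on_eq_continuous_at[OF W(1)], intro ballI)
    fix x assume "x \<in> W"
    then obtain e where e: "e > 0" "cball x e \<subseteq> W"
      using W(1) by (metis open_contains_cball)
    have "continuous_on (cball x e) g"
    proof (rule uniform_limit_theorem[OF _ lim[OF compact_cball e(2)]])
      have "continuous_on (cball x e) (to_sphere \<circ> h (r k))" for k
        using hol[OF hz(1)] e(2)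
        by (intro continuous_on_compose continuous_to_sphere holomorphic_on_imp_continuous_on)
           (auto intro: holomorphic_on_subset)
      then show "\<forall>\<^sub>F k in sequentially. continuous_on (cball x e) (\<lambda>z. to_sphere (h (r k) z))"
        by (simp add: o_def)
    qed auto
    then show "isCont g x"
      using e(1) by (intro continuous_on_interior[of "cball x e"]) (simp_all add: interior_cball)
  qed
  define Z where "Z = {z \<in> W. snd (g z) = 1}"
  have "open Z"
    unfolding Z_def
    using normal_family_limit_infinite_open[OF W(1) _ g lim cont] hol hz(1) by simp
  moreover have "open (W \<inter> (\<lambda>z. snd (g z)) -` (- {1}))"
    by (intro continuous_open_preimage[OF _ W(1)] continuous_intros cont)
  moreover have "W \<inter> (\<lambda>z. snd (g z)) -` (- {1}) = W - Z"
    by (auto simp: Z_def)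
  ultimately have "Z = {} \<or> W - Z = {}"
    using connectedD[OF W(2), of Z "W - Z"] by (auto simp: Z_def)
  moreover have "snd (g p) < 1"
  proof -
    have "(\<lambda>k. snd (to_sphere (h (r k) p))) \<longlonglongrightarrow> snd (g p)"
      using tendsto_uniform_limitI[OF lim[of "{p}"], of p] p(1) by (intro tendsto_snd) auto
    moreover have "snd (to_sphere (h (r k) p)) \<le> (C\<^sup>2 - 1) / (C\<^sup>2 + 1)" for k
    proof -
      have "(norm (h (r k) p))\<^sup>2 \<le> C\<^sup>2"
        using p(2)[OF hz(1)] by (intro power_mono) auto
      moreover have "(t - 1) / (t + 1) \<le> (s - 1) / (s + 1)" if "0 \<le> t" "t \<le> s" for t s :: real
        using that by (simp add: divide_simps algebra_simps)
      ultimately show ?thesis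
        by (simp add: to_sphere_def)
    qed
    ultimately have "snd (g p) \<le> (C\<^sup>2 - 1) / (C\<^sup>2 + 1)"
      by (intro LIMSEQ_le_const2) auto
    also have "\<dots> < 1"
      by (auto simp: divide_simps add_nonneg_pos)
    finally show ?thesis .
  qed
  ultimately have "Z = {}"
    using p(1) by (auto simp: Z_def)
  obtain l s where ls: "l \<in> K" "strict_mono (s :: nat \<Rightarrow> nat)" "(\<lambda>n. z (r (s n))) \<longlonglongrightarrow> l"
    using seq_compactE[OF compact_imp_seq_compact[OF K(1)], of "\<lambda>n. z (r n)"] hz(2)
    by (metis (no_types, lifting) comp_apply ext)
  have "(\<lambda>n. to_sphere (h (r (s n)) (z (r (s n))))) \<longlonglongrightarrow> g l"
  proof (rule Lim_transform2)
    show "(\<lambda>n. g (z (r (s n)))) \<longlonglongrightarrow> g l"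
      using hz(2) K(2) ls(1)
      by (intro continuous_on_tendsto_compose[OF cont ls(3)]) (auto intro!: always_eventually)
    have "uniform_limit K (\<lambda>n y. to_sphere (h (r (s n)) y)) g sequentially"
      by (rule filterlim_compose[OF lim[OF K] filterlim_subseq[OF ls(2)]])
    then have "\<forall>\<^sub>F n in sequentially.
        dist (to_sphere (h (r (s n)) (z (r (s n))))) (g (z (r (s n)))) < e" if "e > 0" for e
      using uniform_limitD[OF _ that] hz(2) by (fast elim!: eventually_mono)
    then show "(\<lambda>n. g (z (r (s n))) - to_sphere (h (r (s n)) (z (r (s n))))) \<longlonglongrightarrow> 0"
      by (auto simp: tendsto_iff dist_norm norm_minus_commute)
  qed
  then have "(\<lambda>n. snd (to_sphere (h (r (s n)) (z (r (s n)))))) \<longlonglongrightarrow> snd (g l)"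
    by (rule tendsto_snd)
  moreover have "(\<lambda>n. snd (to_sphere (h (r (s n)) (z (r (s n)))))) \<longlonglongrightarrow> 1"
  proof (rule real_tendsto_sandwich)
    have le: "real n \<le> norm (h (r (s n)) (z (r (s n))))" for n
    proof -
      have "n \<le> r (s n)"
        using r ls(2) by (meson order_trans seq_suble)
      then show ?thesis
        using hz(3)[of "r (s n)"] by linarith
    qed
    show "\<forall>\<^sub>F n in sequentially. 1 - 2 / ((real n)\<^sup>2 + 1) \<le> snd (to_sphere (h (r (s n)) (z (r (s n)))))"
    proof (intro always_eventually allI)
      fix n
      have "(real n)\<^sup>2 \<le> (norm (h (r (s n)) (z (r (s n)))))\<^sup>2"
        using le[of n] by (intro power_mono) auto
      moreover have "1 - 2 / (t + 1) \<le> (s - 1) / (s + 1)" if "0 \<le> t" "t \<le> s" for t s :: real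
        using that by (simp add: divide_simps algebra_simps)
      ultimately show "1 - 2 / ((real n)\<^sup>2 + 1) \<le> snd (to_sphere (h (r (s n)) (z (r (s n)))))"
        by (simp add: to_sphere_def)
    qed
    have sq: "(x\<^sup>2 - 1) / (x\<^sup>2 + 1) \<le> (1::real)" for x
      by (simp add: divide_simps add_nonneg_pos)
    show "\<forall>\<^sub>F n in sequentially. snd (to_sphere (h (r (s n)) (z (r (s n))))) \<le> 1"
      unfolding to_sphere_def snd_conv by (intro always_eventually allI sq)
    show "(\<lambda>n. 1 - 2 / ((real n)\<^sup>2 + 1)) \<longlonglongrightarrow> 1"
      by real_asymp
  qed auto
  ultimately have "snd (g l) = 1"
    by (rule LIMSEQ_unique)
  then have "l \<in> Z"
    using ls(1) K(2) by (auto simp: Z_def)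
  with \<open>Z = {}\<close> show False by blast
qed

lemma open_fatou_set: "open (fatou_set f U)"
proof (rule Topological_Spaces.openI)
  fix z assume "z \<in> fatou_set f U"
  then obtain W where W: "open W" "z \<in> W" "W \<subseteq> iter_set f U" "normal_family {f ^^ n | n. 1 \<le> n} W"
    unfolding fatou_set_def by auto
  then have "W \<subseteq> fatou_set f U"
    unfolding fatou_set_def using interior_maximal[OF W(3,1)] by blast
  then show "\<exists>T. open T \<and> z \<in> T \<and> T \<subseteq> fatou_set f U"
    using W by blast
qed

text \<open>
  Together with \<open>immediate_basin_bounded\<close> this allows bounded orbits to stand in for normality.
\<close>

lemma bounded_imp_subset_fatou_set:
  assumes "f holomorphic_on U" "open W" "\<And>z n. z \<in> W \<Longrightarrow> (f ^^ n) z \<in> U"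
    and "bounded_on_compacts (range (\<lambda>n. f ^^ n)) W"
  shows "W \<subseteq> fatou_set f U"
proof -
  have "normal_family {f ^^ n | n. 1 \<le> n} W"
  proof (rule bounded_imp_normal_family[OF assms(2)])
    show "h holomorphic_on W" if "h \<in> {f ^^ n | n. 1 \<le> n}" for h
      using that assms(3) by (auto intro!: holomorphic_iterate[OF assms(1)])
    show "bounded_on_compacts {f ^^ n | n. 1 \<le> n} W"
      by (rule bounded_on_compacts_subset[OF assms(4)]) auto
  qed
  moreover have "W \<subseteq> iter_set f U"
    using assms(3) by (auto simp: iter_set_iff)
  moreover from this have "W \<subseteq> interior (iter_set f U)"
    by (intro interior_maximal assms)
  ultimately show ?thesis
    unfolding fatou_set_def using assms(2) by blast
qed

lemma bounded_on_compacts_iterates: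
  assumes "bounded_on_compacts {f ^^ n | n. 1 \<le> n} W"
  shows "bounded_on_compacts (range (\<lambda>n. f ^^ n)) W"
  unfolding bounded_on_compacts_def
proof (intro allI impI)
  fix K :: "complex set" assume K: "compact K" "K \<subseteq> W"
  obtain B where B: "B > 0" "\<And>h z. h \<in> {f ^^ n | n. 1 \<le> n} \<Longrightarrow> z \<in> K \<Longrightarrow> norm (h z) \<le> B"
    by (rule bounded_on_compactsE[OF assms K]) (rule that)
  obtain C where C: "\<And>z. z \<in> K \<Longrightarrow> norm z \<le> C"
    using compact_imp_bounded[OF K(1)] by (auto simp: bounded_iff)
  have "norm ((f ^^ n) z) \<le> max B C" if "z \<in> K" for n z
    using B(2)[of "f ^^ n" z] C[OF that] that by (cases "n = 0") force+
  then show "\<exists>B. \<forall>h\<in>range (\<lambda>n. f ^^ n). \<forall>z\<in>K. norm (h z) \<le> B"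
    by auto
qed

lemma immediate_basin_basics:
  assumes "z0 \<in> fatou_set f U"
  shows "open (immediate_basin z0 f U)" "connected (immediate_basin z0 f U)"
    "z0 \<in> immediate_basin z0 f U" "immediate_basin z0 f U \<subseteq> fatou_set f U"
    "z \<in> immediate_basin z0 f U \<Longrightarrow> (f ^^ n) z \<in> U"
proof -
  show "open (immediate_basin z0 f U)"
    unfolding immediate_basin_def by (rule open_connected_component[OF open_fatou_set])
  show "connected (immediate_basin z0 f U)"
    unfolding immediate_basin_def by (rule connected_connected_component)
  show "z0 \<in> immediate_basin z0 f U"
    unfolding immediate_basin_def using assms by simp
  show *: "immediate_basin z0 f U \<subseteq> fatou_set f U"
    unfolding immediate_basin_def by (rule connected_component_subset)
  have "fatou_set f U \<subseteq> iter_set f U"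
    unfolding fatou_set_def using interior_subset by blast
  with * show "(f ^^ n) z \<in> U" if "z \<in> immediate_basin z0 f U"
    using that by (auto simp: iter_set_iff)
qed

lemma subset_immediate_basin:
  assumes "connected C" "z0 \<in> C" "C \<subseteq> fatou_set f U"
  shows "C \<subseteq> immediate_basin z0 f U"
  unfolding immediate_basin_def using assms by (intro connected_component_maximal)

text \<open>
  Only local normality is given, so \<open>normal_family_bounded\<close> is applied on small balls. It shows that
  boundedness of the orbit is both an open and a closed condition on the component; it holds at the
  fixed point itself.
\<close>

lemma immediate_basin_bounded:
  assumes z0: "z0 \<in> fatou_set f U" "f z0 = z0" and f: "f holomorphic_on U"
  shows "bounded_on_compacts (range (\<lambda>n. f ^^ n)) (immediate_basin z0 f U)"
proof -
  let ?A = "immediate_basin z0 f U" and ?F = "{f ^^ n | n. 1 \<le> n}"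
  note A = immediate_basin_basics[OF z0(1)]
  define PB where "PB p \<longleftrightarrow> (\<exists>C. \<forall>h\<in>?F. norm (h p) \<le> C)" for p
  define LB where "LB z e \<longleftrightarrow> bounded_on_compacts ?F (ball z e)" for z e
  have LB_imp_PB: "PB p" if p: "p \<in> ball z e" and lb: "LB z e" for p z e
  proof -
    have "{p} \<subseteq> ball z e" using p by simp
    then obtain B where "\<And>h y. h \<in> ?F \<Longrightarrow> y \<in> {p} \<Longrightarrow> norm (h y) \<le> B"
      by (rule bounded_on_compactsE[OF lb[unfolded LB_def] compact_sing]) (rule that)
    then show ?thesis unfolding PB_def by blast
  qed
  have normal_near: "\<exists>e>0. ball z e \<subseteq> ?A \<and> (\<forall>p\<in>ball z e. PB p \<longrightarrow> LB z e)" if z: "z \<in> ?A" for z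
  proof -
    have "z \<in> fatou_set f U" using z A(4) by blast
    then obtain W where W: "open W" "z \<in> W" "normal_family ?F W"
      unfolding fatou_set_def by blast
    obtain e where e: "e > 0" "ball z e \<subseteq> W \<inter> ?A"
      using W z A(1) by (metis IntI open_Int open_contains_ball)
    have hol: "h holomorphic_on ball z e" if "h \<in> ?F" for h
      using that e A(5) by (auto intro!: holomorphic_iterate[OF f])
    have nf: "normal_family ?F (ball z e)"
      using e by (intro normal_family_subset[OF W(3)]) auto
    have "LB z e" if "p \<in> ball z e" and pb: "PB p" for p
    proof -
      obtain C where "\<And>h. h \<in> ?F \<Longrightarrow> norm (h p) \<le> C"
        using pb unfolding PB_def by blast
      then show ?thesis
        unfolding LB_def
        by (intro normal_family_bounded[OF open_ball connected_ball hol nf that(1)])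
    qed
    then show ?thesis
      using e by blast
  qed
  define S where "S = {z \<in> ?A. PB z}"
  have S_LB: "\<exists>e>0. ball z e \<subseteq> ?A \<and> LB z e" if "z \<in> S" for z
    using that normal_near[of z] unfolding S_def by (metis (no_types, lifting) centre_in_ball mem_Collect_eq)
  have "open S"
  proof (rule Topological_Spaces.openI)
    fix z assume "z \<in> S"
    then obtain e where e: "e > 0" "ball z e \<subseteq> ?A" "LB z e"
      using S_LB by blast
    then have "ball z e \<subseteq> S"
      using LB_imp_PB unfolding S_def by blast
    then show "\<exists>T. open T \<and> z \<in> T \<and> T \<subseteq> S"
      using e(1) by (intro exI[of _ "ball z e"]) auto
  qed
  moreover have "open (?A - S)"
  proof (rule Topological_Spaces.openI)
    fix z assume z: "z \<in> ?A - S"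
    then obtain e where e: "e > 0" "ball z e \<subseteq> ?A" "\<forall>p\<in>ball z e. PB p \<longrightarrow> LB z e"
      using normal_near[of z] by blast
    have "\<not> LB z e"
      using LB_imp_PB[of z z e] z e(1) unfolding S_def by auto
    then have "ball z e \<subseteq> ?A - S"
      using e unfolding S_def by blast
    then show "\<exists>T. open T \<and> z \<in> T \<and> T \<subseteq> ?A - S"
      using e(1) by (intro exI[of _ "ball z e"]) auto
  qed
  moreover have "z0 \<in> S"
  proof -
    have "norm (h z0) \<le> norm z0" if "h \<in> ?F" for h
      using that iterate_fixpoint[of f, OF z0(2)] by auto
    then have "PB z0" unfolding PB_def by blast
    then show ?thesis using A(3) unfolding S_def by blast
  qed
  moreover have "S \<subseteq> ?A" unfolding S_def by blast
  ultimately have "?A \<subseteq> S"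
    using connectedD[OF A(2), of S "?A - S"] A(3) by blast
  have "bounded_on_compacts ?F ?A"
  proof (rule bounded_on_compactsI)
    fix z assume "z \<in> ?A"
    then obtain e where e: "e > 0" "bounded_on_compacts ?F (ball z e)"
      using \<open>?A \<subseteq> S\<close> S_LB[of z] unfolding LB_def by blast
    have "cball z (e/2) \<subseteq> ball z e" using e(1) by auto
    then obtain B where B: "\<And>h y. h \<in> ?F \<Longrightarrow> y \<in> cball z (e/2) \<Longrightarrow> norm (h y) \<le> B"
      by (rule bounded_on_compactsE[OF e(2) compact_cball]) (rule that)
    then show "\<exists>e>0. \<exists>B. \<forall>h\<in>?F. \<forall>y\<in>ball z e \<inter> ?A. norm (h y) \<le> B"
      using e(1) by (intro exI[of _ "e/2"] conjI exI[of _ B]) auto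
  qed
  then show ?thesis by (rule bounded_on_compacts_iterates)
qed

section \<open>Locally uniform limits and Hurwitz' theorem\<close>

lemma compact_closed_neighbourhood:
  fixes U :: "complex set"
  assumes "compact K" "open U" "K \<subseteq> U"
  obtains e L where "e > 0" "compact L" "L \<subseteq> U" "\<And>x. x \<in> K \<Longrightarrow> cball x e \<subseteq> L"
proof -
  obtain e where e: "e > 0" "(\<Union>x\<in>K. cball x e) \<subseteq> U"
    using compact_subset_open_imp_cball_epsilon_subset[OF assms] by blast
  show thesis
  proof (rule that[OF e(1)])
    let ?L = "{x + y | x y. x \<in> K \<and> y \<in> cball 0 e}"
    show "compact ?L"
      using compact_sums[OF assms(1) compact_cball] .
    show "?L \<subseteq> U"
      using e by (force simp: dist_norm)
    show "cball x e \<subseteq> ?L" if "x \<in> K" for x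
    proof
      fix y assume "y \<in> cball x e"
      then have "y = x + (y - x)" "y - x \<in> cball 0 e"
        by (auto simp: dist_norm norm_minus_commute)
      with that show "y \<in> ?L" by blast
    qed
  qed
qed

lemma uniform_limit_compose_locally:
  fixes U :: "complex set" and g :: "nat \<Rightarrow> complex \<Rightarrow> complex" and f :: "nat \<Rightarrow> complex \<Rightarrow> complex"
  assumes U: "open U" and f: "\<And>K. compact K \<Longrightarrow> K \<subseteq> U \<Longrightarrow> uniform_limit K f f0 sequentially"
    and f0: "continuous_on U f0"
    and K: "compact K" and g: "uniform_limit K g g0 sequentially" "continuous_on K g0" "g0 ` K \<subseteq> U"
  shows "uniform_limit K (\<lambda>n z. f n (g n z)) (\<lambda>z. f0 (g0 z)) sequentially"
proof (rule uniform_limitI)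
  fix e :: real assume "e > 0"
  obtain d L where L: "d > 0" "compact L" "L \<subseteq> U" "\<And>x. x \<in> g0 ` K \<Longrightarrow> cball x d \<subseteq> L"
    using compact_closed_neighbourhood[OF compact_continuous_image[OF g(2) K] U g(3)] by blast
  have "uniformly_continuous_on L f0"
    using L f0 by (intro compact_uniformly_continuous) (auto intro: continuous_on_subset)
  then obtain d' where d': "d' > 0" "\<And>x y. x \<in> L \<Longrightarrow> y \<in> L \<Longrightarrow> dist x y < d' \<Longrightarrow> dist (f0 x) (f0 y) < e/2"
    using \<open>e > 0\<close> unfolding uniformly_continuous_on_def by (metis half_gt_zero)
  have "\<forall>\<^sub>F n in sequentially. \<forall>z\<in>K. dist (g n z) (g0 z) < min d d'"
    using L(1) d'(1) by (intro uniform_limitD[OF g(1)]) auto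
  moreover have "\<forall>\<^sub>F n in sequentially. \<forall>z\<in>L. dist (f n z) (f0 z) < e/2"
    using \<open>e > 0\<close> by (intro uniform_limitD[OF f[OF L(2,3)]]) auto
  ultimately show "\<forall>\<^sub>F n in sequentially. \<forall>z\<in>K. dist (f n (g n z)) (f0 (g0 z)) < e"
  proof eventually_elim
    case (elim n)
    show ?case
    proof
      fix z assume z: "z \<in> K"
      have "g0 z \<in> cball (g0 z) d" "g n z \<in> cball (g0 z) d"
        using elim(1) z L(1) by (auto simp: dist_commute less_imp_le)
      then have in_L: "g0 z \<in> L" "g n z \<in> L"
        using L(4)[of "g0 z"] z by auto
      have "dist (f n (g n z)) (f0 (g n z)) < e/2"
        using elim(2) in_L by blast
      moreover have "dist (f0 (g n z)) (f0 (g0 z)) < e/2"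
        using elim(1) in_L z by (intro d') auto
      ultimately show "dist (f n (g n z)) (f0 (g0 z)) < e"
        using dist_triangle_half_r by (metis dist_triangle_half_l dist_commute)
    qed
  qed
qed

text \<open>
  The orbit has to stay in \<open>U\<close> for the steps before the last only. This gives convergence of an iterate
  before it is known whether that iterate maps into \<open>U\<close>.
\<close>

lemma uniform_limit_iterates:
  assumes U: "open U" and f: "\<And>K. compact K \<Longrightarrow> K \<subseteq> U \<Longrightarrow> uniform_limit K f f0 sequentially"
    and f0: "f0 holomorphic_on U" and K: "compact K" "\<And>z k. z \<in> K \<Longrightarrow> k < m \<Longrightarrow> (f0 ^^ k) z \<in> U"
  shows "uniform_limit K (\<lambda>n. f n ^^ m) (f0 ^^ m) sequentially"
  using K(2)
proof (induction m)
  case 0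
  show ?case by (auto intro!: uniform_limitI)
next
  case (Suc m)
  have "(f0 ^^ m) holomorphic_on K"
    using Suc.prems by (intro holomorphic_iterate[OF f0]) auto
  then have "uniform_limit K (\<lambda>n z. f n ((f n ^^ m) z)) (\<lambda>z. f0 ((f0 ^^ m) z)) sequentially"
    using Suc by (intro uniform_limit_compose_locally[OF U f holomorphic_on_imp_continuous_on[OF f0] K(1)])
      (auto intro: holomorphic_on_imp_continuous_on)
  then show ?case by (simp add: o_def)
qed

lemma uniform_limit_eventually_avoids:
  fixes g :: "'a :: topological_space \<Rightarrow> complex"
  assumes "uniform_limit K h g F" "compact K" "continuous_on K g" "\<And>z. z \<in> K \<Longrightarrow> g z \<noteq> a"
  obtains m where "m > 0" "\<forall>\<^sub>F n in F. \<forall>z\<in>K. norm (h n z - a) > m"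
proof -
  obtain m where m: "m > 0" "\<And>z. z \<in> K \<Longrightarrow> norm (g z - a) \<ge> m"
  proof (cases "K = {}")
    case False
    have "continuous_on K (\<lambda>z. norm (g z - a))"
      by (intro continuous_intros assms)
    from continuous_attains_inf[OF assms(2) False this] obtain x
      where "x \<in> K" "\<And>y. y \<in> K \<Longrightarrow> norm (g x - a) \<le> norm (g y - a)" by blast
    then show thesis using assms(4)[of x] by (intro that[of "norm (g x - a)"]) auto
  qed (use that[of 1] in auto)
  have "\<forall>\<^sub>F n in F. \<forall>z\<in>K. dist (h n z) (g z) < m/2"
    using m by (intro uniform_limitD[OF assms(1)]) auto
  then have "\<forall>\<^sub>F n in F. \<forall>z\<in>K. norm (h n z - a) > m/2"
  proof eventually_elim
    case (elim n)
    show ?case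
    proof
      fix z assume z: "z \<in> K"
      have "norm (g z - a) \<le> norm (h n z - a) + dist (h n z) (g z)"
        using norm_triangle_ineq[of "h n z - a" "g z - h n z"] by (simp add: dist_norm norm_minus_commute)
      then show "norm (h n z - a) > m/2" using elim z m(2)[OF z] by force
    qed
  qed
  then show thesis using m(1) by (intro that[of "m/2"]) auto
qed

text \<open>
  Hurwitz' theorem in a form for functions that are holomorphic and free of zeros only eventually, on each
  compact subset of a neighbourhood \<open>N\<close> of the point. The set \<open>C\<close> serves to exclude a constant limit.
\<close>

lemma Hurwitz_eventually_no_zeros:
  fixes h :: "nat \<Rightarrow> complex \<Rightarrow> complex"
  assumes C: "open C" "connected C" and g: "g holomorphic_on C" "\<not> g constant_on C"
    and N: "open N" "N \<subseteq> C" "z \<in> N"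
    and lim: "\<And>K. compact K \<Longrightarrow> K \<subseteq> N \<Longrightarrow> uniform_limit K h g sequentially"
    and nz: "\<And>K. compact K \<Longrightarrow> K \<subseteq> N \<Longrightarrow>
         \<forall>\<^sub>F n in sequentially. h n holomorphic_on K \<and> (\<forall>z\<in>K. h n z \<noteq> 0)"
  shows "g z \<noteq> 0"
proof -
  obtain e where e: "e > 0" "cball z e \<subseteq> N"
    using N by (metis open_contains_cball)
  obtain n0 where n0: "\<And>n. n \<ge> n0 \<Longrightarrow> h n holomorphic_on cball z e \<and> (\<forall>z\<in>cball z e. h n z \<noteq> 0)"
    using nz[OF compact_cball e(2)] unfolding eventually_sequentially by blast
  have sub: "ball z e \<subseteq> N" "ball z e \<subseteq> C"
    using e N(2) ball_subset_cball by blast+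
  show ?thesis
  proof (rule Hurwitz_no_zeros[of "ball z e" "\<lambda>n. h (n + n0)" g])
    show "h (n + n0) holomorphic_on ball z e" for n
      using n0[of "n + n0"] by (auto intro: holomorphic_on_subset)
    show "uniform_limit K (\<lambda>n. h (n + n0)) g sequentially" if "compact K" "K \<subseteq> ball z e" for K
      using filterlim_compose[OF lim[of K] filterlim_add_const_nat_at_top] that sub by blast
    show "\<not> g constant_on ball z e"
    proof
      assume "g constant_on ball z e"
      then obtain c where c: "\<And>w. w \<in> ball z e \<Longrightarrow> g w = c"
        unfolding constant_on_def by blast
      have "g w = c" if "w \<in> C" for w
        by (rule analytic_continuation_open[of "ball z e" C g "\<lambda>_. c"]) (use C e sub g c that in auto)
      then show False using g(2) unfolding constant_on_def by blast
    qed
    show "h (n + n0) w \<noteq> 0" if "w \<in> ball z e" for n w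
      using n0[of "n + n0"] that by auto
  qed (use e sub g in \<open>auto intro: holomorphic_on_subset\<close>)
qed

text \<open>
  A form of Montel's theorem for families omitting \<open>0\<close> and \<open>1\<close>. Members of norm at most \<open>1\<close> at \<open>w\<close> are
  covered by Schottky's theorem. So are the reciprocals of the others, and a blow-up of these others on a
  compact set would give a limit of reciprocals with a zero; by Hurwitz that limit would vanish
  identically, but at \<open>w\<close> its norm is at least \<open>1 / M\<close>.
\<close>

lemma omits_0_1_bounded:
  assumes S: "open S" "connected S" "w \<in> S"
    and hol: "\<And>h. h \<in> F \<Longrightarrow> h holomorphic_on S"
    and omit: "\<And>h z. h \<in> F \<Longrightarrow> z \<in> S \<Longrightarrow> h z \<noteq> 0 \<and> h z \<noteq> 1"
    and M: "\<And>h. h \<in> F \<Longrightarrow> norm (h w) \<le> M"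
  shows "bounded_on_compacts F S"
  unfolding bounded_on_compacts_def
proof (intro allI impI, rule ccontr)
  fix K assume K: "compact K" "K \<subseteq> S" and unb: "\<nexists>B. \<forall>h\<in>F. \<forall>z\<in>K. norm (h z) \<le> B"
  obtain B1 where B1: "\<And>h z. h \<in> {h \<in> F. norm (h w) \<le> 1} \<Longrightarrow> z \<in> K \<Longrightarrow> norm (h z) \<le> B1"
  proof (rule GPicard3[of S w "{h \<in> F. norm (h w) \<le> 1}" F K])
    fix B assume "\<And>h z. h \<in> {h \<in> F. norm (h w) \<le> 1} \<Longrightarrow> z \<in> K \<Longrightarrow> norm (h z) \<le> B"
    then show thesis by (rule that)
  qed (use S K hol omit in auto)
  have "\<exists>h z. h \<in> F \<and> z \<in> K \<and> norm (h z) > real n + \<bar>B1\<bar>" for n :: nat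
    using unb by (meson not_le)
  then obtain h z where hz: "\<And>n. h n \<in> F" "\<And>n. z n \<in> K" "\<And>n. norm (h n (z n)) > real n + \<bar>B1\<bar>"
    by metis
  have hw: "norm (h n w) > 1" for n
  proof (rule ccontr)
    assume "\<not> norm (h n w) > 1"
    then have "norm (h n (z n)) \<le> B1"
      using hz(1,2)[of n] by (intro B1) auto
    with hz(3)[of n] show False by linarith
  qed
  define G where "G n = (\<lambda>y. inverse (h n y))" for n
  have G_hol: "G n holomorphic_on S" for n
    unfolding G_def using hz(1) omit by (intro holomorphic_intros hol) auto
  have G_omit: "G n y \<noteq> 0 \<and> G n y \<noteq> 1" if "y \<in> S" for n y
    using omit[OF hz(1) that, of n] unfolding G_def by (metis inverse_1 inverse_inverse_eq inverse_zero)
  have G_w: "norm (G n w) \<le> 1" for n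
    using hw[of n] unfolding G_def by (simp add: norm_inverse inverse_le_1_iff)
  have "bounded_on_compacts (range G) S"
    unfolding bounded_on_compacts_def
  proof (intro allI impI)
    fix K' assume K': "compact K'" "K' \<subseteq> S"
    obtain B where "\<And>h z. h \<in> range G \<Longrightarrow> z \<in> K' \<Longrightarrow> norm (h z) \<le> B"
    proof (rule GPicard3[of S w "range G" "range G" K'])
      fix B assume "\<And>h z. h \<in> range G \<Longrightarrow> z \<in> K' \<Longrightarrow> norm (h z) \<le> B"
      then show thesis by (rule that)
    qed (use S K' G_hol G_omit G_w in auto)
    then show "\<exists>B. \<forall>h\<in>range G. \<forall>z\<in>K'. norm (h z) \<le> B" by blast
  qed
  then obtain g r where g: "g holomorphic_on S" "strict_mono (r :: nat \<Rightarrow> nat)"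
      "\<And>x. x \<in> S \<Longrightarrow> (\<lambda>n. G (r n) x) \<longlonglongrightarrow> g x"
      "\<And>K. compact K \<Longrightarrow> K \<subseteq> S \<Longrightarrow> uniform_limit K (\<lambda>n. G (r n)) g sequentially"
    by (rule Montel_subsequence[OF S(1) G_hol]) (rule that)
  have "norm (g w) \<ge> inverse M"
  proof (rule LIMSEQ_le_const[OF tendsto_norm[OF g(3)[OF S(3)]]])
    have "norm (G n w) \<ge> inverse M" for n
      using hw[of n] M[OF hz(1), of n] unfolding G_def norm_inverse
      by (intro le_imp_inverse_le) linarith+
    then show "\<exists>N. \<forall>n\<ge>N. inverse M \<le> norm (G (r n) w)" by blast
  qed
  moreover have "M > 0"
    using hw[of 0] M[OF hz(1), of 0] by linarith
  ultimately have gw: "g w \<noteq> 0" by auto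
  have g_nz: "g y \<noteq> 0" if "y \<in> S" for y
  proof (cases "g constant_on S")
    case True
    then show ?thesis using gw S(3) that unfolding constant_on_def by metis
  next
    case False
    show ?thesis
      by (rule Hurwitz_no_zeros[of S "\<lambda>n. G (r n)" g]) (use S G_hol g G_omit that False in auto)
  qed
  obtain m where m: "m > 0" "\<forall>\<^sub>F n in sequentially. \<forall>y\<in>K. norm (G (r n) y - 0) > m"
  proof (rule uniform_limit_eventually_avoids[OF g(4)[OF K] K(1), of 0])
    show "continuous_on K g"
      using g(1) K(2) by (meson holomorphic_on_imp_continuous_on continuous_on_subset)
  qed (use g_nz K(2) in auto)
  obtain n1 where n1: "\<And>n. n \<ge> n1 \<Longrightarrow> \<forall>y\<in>K. norm (G (r n) y - 0) > m"
    using m(2) unfolding eventually_sequentially by blast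
  obtain n2 :: nat where n2: "inverse m < real n2" using reals_Archimedean2 by blast
  define n where "n = max n1 n2"
  have "norm (G (r n) (z (r n))) > m"
    using n1[of n] hz(2) unfolding n_def by auto
  then have "norm (h (r n) (z (r n))) < inverse m"
    unfolding G_def norm_inverse using m(1)
    by (metis inverse_inverse_eq inverse_less_imp_less less_imp_inverse_less)
  moreover have "n2 \<le> r n"
    using seq_suble[OF g(2), of n] unfolding n_def by linarith
  ultimately show False
    using hz(3)[of "r n"] n2 by linarith
qed

section \<open>Attracting basins and maximality of the kernel\<close>

lemma has_derivative_iterate_fixpoint:
  assumes "f holomorphic_on U" "open U" "z0 \<in> U" "f z0 = z0"
  shows "((f ^^ n) has_field_derivative (deriv f z0) ^ n) (at z0)"
proof (induction n)
  case 0
  show ?case by (simp add: id_def)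
next
  case (Suc n)
  have "(f has_field_derivative deriv f z0) (at ((f ^^ n) z0))"
    using assms by (simp add: iterate_fixpoint holomorphic_derivI)
  from DERIV_chain[OF this Suc] show ?case
    by (simp add: o_def)
qed

lemma not_constant_on_deriv:
  assumes "(g has_field_derivative d) (at z0)" "d \<noteq> 0" "open A" "z0 \<in> A"
  shows "\<not> g constant_on A"
proof
  assume "g constant_on A"
  then obtain c where c: "\<And>z. z \<in> A \<Longrightarrow> g z = c"
    unfolding constant_on_def by blast
  have "((\<lambda>_. c) has_field_derivative d) (at z0)"
    by (rule has_field_derivative_transform_within_open[OF assms(1,3,4)]) (simp add: c)
  from DERIV_unique[OF this DERIV_const] show False using assms(2) by simp
qed

lemma attracting_fixpoint_contraction:
  assumes "open U" "f holomorphic_on U" "attracting_fixpoint f U z0"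
  obtains c d where "0 < c" "c < 1" "d > 0" "ball z0 d \<subseteq> U"
    "\<And>z n. z \<in> ball z0 d \<Longrightarrow> norm ((f ^^ n) z - z0) \<le> c ^ n * norm (z - z0)"
proof -
  have z0: "z0 \<in> U" "f z0 = z0" "norm (deriv f z0) < 1"
    using assms(3) unfolding attracting_fixpoint_def by auto
  obtain c where c: "norm (deriv f z0) < c" "c < 1"
    using z0(3) dense by blast
  have c0: "c > 0" using c(1) norm_ge_zero[of "deriv f z0"] by linarith
  have "((\<lambda>z. (f z - f z0) / (z - z0)) \<longlongrightarrow> deriv f z0) (at z0)"
    using holomorphic_derivI[OF assms(2,1) z0(1)] by (simp add: has_field_derivative_iff)
  from order_tendstoD(2)[OF tendsto_norm[OF this] c(1)]
  obtain d1 where d1: "d1 > 0" "\<And>z. z \<noteq> z0 \<Longrightarrow> dist z z0 < d1 \<Longrightarrow> norm ((f z - f z0) / (z - z0)) < c"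
    unfolding eventually_at by auto
  have step1: "norm (f z - z0) \<le> c * norm (z - z0)" if "dist z z0 < d1" for z
    using d1(2)[OF _ that] z0(2) by (cases "z = z0") (auto simp: norm_divide field_simps)
  obtain d2 where d2: "d2 > 0" "ball z0 d2 \<subseteq> U"
    using assms(1) z0(1) by (metis open_contains_ball)
  define d where "d = min d1 d2"
  have "norm ((f ^^ n) z - z0) \<le> c ^ n * norm (z - z0)" if z: "z \<in> ball z0 d" for z n
  proof (induction n)
    case (Suc n)
    have "c ^ n * norm (z - z0) \<le> 1 * norm (z - z0)"
      using c c0 by (intro mult_right_mono power_le_one) auto
    then have "norm ((f ^^ n) z - z0) < d1"
      using Suc z unfolding d_def by (simp add: dist_norm norm_minus_commute)
    then have "norm (f ((f ^^ n) z) - z0) \<le> c * norm ((f ^^ n) z - z0)"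
      by (intro step1) (simp add: dist_norm)
    also have "\<dots> \<le> c * (c ^ n * norm (z - z0))"
      using c0 Suc by (intro mult_left_mono) auto
    finally show ?case by simp
  qed simp
  moreover have "ball z0 d \<subseteq> U" using d2 unfolding d_def by auto
  ultimately show thesis
    using c0 c d1 d2 by (intro that[of c d]) (auto simp: d_def)
qed

lemma attracting_fixpoint_in_fatou_set:
  assumes "open U" "f holomorphic_on U" "attracting_fixpoint f U z0"
  shows "z0 \<in> fatou_set f U"
proof -
  obtain c d where cd: "0 < c" "c < 1" "d > 0" "ball z0 d \<subseteq> U"
    "\<And>z n. z \<in> ball z0 d \<Longrightarrow> norm ((f ^^ n) z - z0) \<le> c ^ n * norm (z - z0)"
    by (rule attracting_fixpoint_contraction[OF assms]) (rule that)
  have in_ball: "(f ^^ n) z \<in> ball z0 d" if z: "z \<in> ball z0 d" for z n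
  proof -
    have "c ^ n * norm (z - z0) \<le> 1 * norm (z - z0)"
      using cd by (intro mult_right_mono power_le_one) auto
    then show ?thesis
      using cd(5)[OF z, of n] z by (simp add: dist_norm norm_minus_commute)
  qed
  have "ball z0 d \<subseteq> fatou_set f U"
  proof (rule bounded_imp_subset_fatou_set[OF assms(2) open_ball])
    show "(f ^^ n) z \<in> U" if "z \<in> ball z0 d" for z n
      using in_ball[OF that] cd(4) by blast
    have "norm ((f ^^ n) z) \<le> norm z0 + d" if "z \<in> ball z0 d" for z n
      using in_ball[OF that, of n] norm_triangle_ineq2[of "(f ^^ n) z" z0]
      by (simp add: dist_norm norm_minus_commute)
    then show "bounded_on_compacts (range (\<lambda>n. f ^^ n)) (ball z0 d)"
      unfolding bounded_on_compacts_def by blast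
  qed
  then show ?thesis using cd(3) by auto
qed

text \<open>
  The iterates \<open>f\<^sup>1\<^sup>+\<^sup>k\<^sup>i\<close> converge to \<open>z0\<close> near \<open>z0\<close>, hence by the identity theorem a locally uniform limit of a
  subsequence is \<open>z0\<close> on the whole basin, whereas at a point \<open>z\<close> with periodic image \<open>f z\<close> they are
  constantly \<open>f z\<close>.
\<close>

lemma attracting_basin_periodic:
  assumes U: "open U" "f holomorphic_on U" and att: "attracting_fixpoint f U z0"
    and z: "z \<in> immediate_basin z0 f U" and k: "k \<ge> 1" "(f ^^ Suc k) z = f z"
  shows "f z = z0"
proof -
  note F = attracting_fixpoint_in_fatou_set[OF U att]
  note A = immediate_basin_basics[OF F]
  have fz0: "f z0 = z0" using att unfolding attracting_fixpoint_def by auto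
  define h where "h i = f ^^ (Suc (k * i))" for i
  obtain c d where cd: "0 < c" "c < 1" "d > 0" "ball z0 d \<subseteq> U"
    "\<And>z n. z \<in> ball z0 d \<Longrightarrow> norm ((f ^^ n) z - z0) \<le> c ^ n * norm (z - z0)"
    by (rule attracting_fixpoint_contraction[OF U att]) (rule that)
  have "h i holomorphic_on immediate_basin z0 f U" for i
    unfolding h_def by (rule holomorphic_iterate[OF U(2) A(5)])
  moreover have "bounded_on_compacts (range h) (immediate_basin z0 f U)"
    by (rule bounded_on_compacts_subset[OF immediate_basin_bounded[of z0 f, OF F fz0 U(2)]]) (use h_def in blast, simp)
  ultimately obtain g r where g: "g holomorphic_on immediate_basin z0 f U" "strict_mono (r :: nat \<Rightarrow> nat)"
      "\<And>x. x \<in> immediate_basin z0 f U \<Longrightarrow> (\<lambda>n. h (r n) x) \<longlonglongrightarrow> g x"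
      "\<And>K. compact K \<Longrightarrow> K \<subseteq> immediate_basin z0 f U \<Longrightarrow> uniform_limit K (\<lambda>n. h (r n)) g sequentially"
    by (rule Montel_subsequence[OF A(1)]) (rule that)
  have g_near: "g w = z0" if w: "w \<in> ball z0 d" "w \<in> immediate_basin z0 f U" for w
  proof (rule LIMSEQ_unique[OF g(3)[OF w(2)]])
    have "(\<lambda>n. (f ^^ n) w - z0) \<longlonglongrightarrow> 0"
    proof (rule Lim_null_comparison)
      show "\<forall>\<^sub>F n in sequentially. norm ((f ^^ n) w - z0) \<le> c ^ n * norm (w - z0)"
        using cd(5)[OF w(1)] by (intro always_eventually allI)
      show "(\<lambda>n. c ^ n * norm (w - z0)) \<longlonglongrightarrow> 0"
        using cd(1,2) by (intro tendsto_mult_left_zero LIMSEQ_power_zero) auto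
    qed
    then have "(\<lambda>n. (f ^^ n) w) \<longlonglongrightarrow> z0"
      by (rule LIM_zero_cancel)
    then have "((\<lambda>n. (f ^^ n) w) \<circ> (\<lambda>i. Suc (k * r i))) \<longlonglongrightarrow> z0"
    proof (rule LIMSEQ_subseq_LIMSEQ)
      show "strict_mono (\<lambda>i. Suc (k * r i))"
        using g(2) k(1) by (auto simp: strict_mono_def)
    qed
    then show "(\<lambda>n. h (r n) w) \<longlonglongrightarrow> z0"
      by (simp add: h_def o_def)
  qed
  have "ball z0 d \<inter> immediate_basin z0 f U \<noteq> {}"
    using A(3) cd(3) by (auto simp: disjoint_iff intro!: exI[of _ z0])
  then have "g z = z0"
    using g_near A(1,2) g(1) z
    by (rule_tac analytic_continuation_open[where f = g and g = "\<lambda>_. z0" and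
          s = "ball z0 d \<inter> immediate_basin z0 f U" and s' = "immediate_basin z0 f U"]) (simp_all add: open_Int)
  moreover have "(\<lambda>n. h (r n) z) \<longlonglongrightarrow> g z" by (rule g(3)[OF z])
  moreover have "h i z = f z" for i
  proof (induction i)
    case (Suc i)
    have "Suc (k * Suc i) = k * i + Suc k" by simp
    then have "h (Suc i) z = (f ^^ (k * i)) ((f ^^ Suc k) z)"
      unfolding h_def by (metis funpow_add comp_apply)
    also have "\<dots> = (f ^^ (k * i)) ((f ^^ 1) z)"
      using k(2) by simp
    also have "\<dots> = h i z"
      unfolding h_def by (metis funpow_add comp_apply Suc_eq_plus1)
    finally show ?case using Suc by simp
  qed (simp add: h_def)
  ultimately show ?thesis
    by (simp add: LIMSEQ_const_iff)
qed

text \<open>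
  Maximality of the kernel. Periodic points persist under perturbation by Hurwitz' theorem, and the basin
  of an attracting fixed point contains no periodic point besides it; so on \<open>C\<close> the iterates of \<open>f0\<close> omit the two functions
  \<open>z\<close> and \<open>f0 z\<close> away from the zeros of \<open>f0 z - z0\<close>, and Montel's theorem applies to them.
\<close>

lemma kernel_subset_fatou_set:
  fixes f :: "nat \<Rightarrow> complex \<Rightarrow> complex"
  assumes U: "open U" and f0: "f0 holomorphic_on U" and f: "\<And>n. f n holomorphic_on U"
    and conv: "\<And>K. compact K \<Longrightarrow> K \<subseteq> U \<Longrightarrow> uniform_limit K f f0 sequentially"
    and fz0: "f0 z0 = z0" and fatou: "z0 \<in> fatou_set f0 U"
    and mult: "deriv f0 z0 \<noteq> 0" "\<And>k. k \<ge> 1 \<Longrightarrow> deriv f0 z0 ^ k \<noteq> 1"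
    and att: "\<And>n. attracting_fixpoint (f n) U z0"
    and C: "open C" "connected C" "z0 \<in> C"
    and cover: "eventually_covers_compacts (\<lambda>n. immediate_basin z0 (f n) U) C"
  shows "C \<subseteq> fatou_set f0 U"
proof -
  note basin = immediate_basin_basics[OF attracting_fixpoint_in_fatou_set[OF U f att]]
  have cov: "\<forall>\<^sub>F n in sequentially. K \<subseteq> immediate_basin z0 (f n) U" if "compact K" "K \<subseteq> C" for K
    using cover that unfolding eventually_covers_compacts_def by blast
  have z0U: "z0 \<in> U" using att[of 0] unfolding attracting_fixpoint_def by auto
  have CU: "C \<subseteq> U"
  proof
    fix z assume "z \<in> C"
    then have "\<forall>\<^sub>F n in sequentially. {z} \<subseteq> immediate_basin z0 (f n) U"
      by (intro cov) auto
    then obtain n where "z \<in> immediate_basin z0 (f n) U"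
      using eventually_happens'[OF sequentially_bot] by fast
    from basin(5)[OF this, of 0] show "z \<in> U" by simp
  qed
  have der: "((f0 ^^ k) has_field_derivative deriv f0 z0 ^ k) (at z0)" for k
    by (rule has_derivative_iterate_fixpoint[OF f0 U z0U fz0])
  have iter_U: "(f0 ^^ k) z \<in> U" if "z \<in> C" for k z
    using that
  proof (induction k arbitrary: z rule: less_induct)
    case (less k)
    define a where "a = (f0 ^^ k) z"
    have hol: "(f0 ^^ k) holomorphic_on C"
      using less.IH by (intro holomorphic_iterate[OF f0]) auto
    show ?case
    proof (rule ccontr)
      assume "(f0 ^^ k) z \<notin> U"
      then have aU: "a \<notin> U" by (simp add: a_def)
      \<comment> \<open>The iterates of \<open>f n\<close> omit \<open>a\<close> on compact subsets of \<open>C\<close>, as they stay in \<open>U\<close> there.\<close>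
      have "(f0 ^^ k) z - a \<noteq> 0"
      proof (rule Hurwitz_eventually_no_zeros[OF C(1,2) _ _ C(1) order.refl less.prems, where h = "\<lambda>n z. (f n ^^ k) z - a"])
        show "(\<lambda>z. (f0 ^^ k) z - a) holomorphic_on C"
          by (intro holomorphic_intros hol)
        have "((\<lambda>z. (f0 ^^ k) z - a) has_field_derivative deriv f0 z0 ^ k - 0) (at z0)"
          by (intro derivative_intros der)
        then show "\<not> (\<lambda>z. (f0 ^^ k) z - a) constant_on C"
          by (rule not_constant_on_deriv) (use mult(1) C in auto)
        fix K assume K: "compact K" "K \<subseteq> C"
        have "uniform_limit K (\<lambda>n. f n ^^ k) (f0 ^^ k) sequentially"
          using less.IH K by (intro uniform_limit_iterates[OF U conv f0]) auto
        then show "uniform_limit K (\<lambda>n z. (f n ^^ k) z - a) (\<lambda>z. (f0 ^^ k) z - a) sequentially"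
          by (intro uniform_limit_intros)
        show "\<forall>\<^sub>F n in sequentially. (\<lambda>z. (f n ^^ k) z - a) holomorphic_on K \<and> (\<forall>z\<in>K. (f n ^^ k) z - a \<noteq> 0)"
          using cov[OF K]
        proof eventually_elim
          case (elim n)
          then have inU: "(f n ^^ j) z \<in> U" if "z \<in> K" for j z
            using basin(5)[of z n j] that by blast
          then have "(f n ^^ k) holomorphic_on K"
            by (intro holomorphic_iterate[OF f]) auto
          with inU aU show ?case
            by (auto intro!: holomorphic_intros)
        qed
      qed
      then show False by (simp add: a_def)
    qed
  qed
  have hol: "(f0 ^^ k) holomorphic_on C" for k
    using iter_U by (intro holomorphic_iterate[OF f0]) auto
  have lim: "uniform_limit K (\<lambda>n. f n ^^ k) (f0 ^^ k) sequentially" if "compact K" "K \<subseteq> C" for K k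
    using iter_U that by (intro uniform_limit_iterates[OF U conv f0]) auto
  define C' where "C' = {z \<in> C. f0 z \<noteq> z0}"
  have C'_eq: "C' = C \<inter> f0 -` (- {z0})" by (auto simp: C'_def)
  have cont: "continuous_on C f0"
    using f0 CU by (meson holomorphic_on_imp_continuous_on continuous_on_subset)
  have C'_open: "open C'"
    unfolding C'_eq by (intro continuous_open_preimage cont C) auto
  have der0: "((\<lambda>z. f0 z - z0) has_field_derivative deriv f0 z0) (at z0)"
    using DERIV_diff[OF holomorphic_derivI[OF f0 U z0U] DERIV_const] by simp
  have nc1: "\<not> (\<lambda>z. f0 z - z0) constant_on C"
    by (rule not_constant_on_deriv[OF der0 mult(1) C(1,3)])
  have hol0: "f0 holomorphic_on C" using f0 CU by (rule holomorphic_on_subset)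
  have C'_conn: "connected C'"
  proof -
    obtain X :: "nat \<Rightarrow> complex set" where X: "\<And>n. compact (X n)" "\<Union>(range X) = C"
      by (rule open_Union_compact_subsets[OF C(1)]) (rule that)
    have "fsigma C"
      unfolding fsigma_Union_compact by (rule exI[of _ X]) (use X in auto)
    then have "countable {z \<in> C. f0 z - z0 = 0}"
      using nc1 C hol0 by (intro holomorphic_countable_zeros holomorphic_intros)
    then have "connected (C - {z \<in> C. f0 z - z0 = 0})"
      using C by (intro connected_open_diff_countable) auto
    moreover have "C - {z \<in> C. f0 z - z0 = 0} = C'" by (auto simp: C'_def)
    ultimately show ?thesis by simp
  qed
  \<comment> \<open>If \<open>f0 z\<close> were periodic, then so would be \<open>f n z\<^sub>n\<close> for points \<open>z\<^sub>n\<close> near \<open>z\<close> in the basin of \<open>f n\<close>, forcing \<open>f n z\<^sub>n = z0\<close>.\<close>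
  have periodic: "(f0 ^^ Suc k) z \<noteq> f0 z" if z: "z \<in> C'" and k: "k \<ge> 1" for z k
  proof -
    have "(f0 ^^ Suc k) z - f0 z \<noteq> 0"
    proof (rule Hurwitz_eventually_no_zeros[OF C(1,2) _ _ C'_open _ z, where h = "\<lambda>n z. (f n ^^ Suc k) z - f n z"])
      show "(\<lambda>z. (f0 ^^ Suc k) z - f0 z) holomorphic_on C"
        by (intro holomorphic_intros hol hol0)
      have "((\<lambda>z. (f0 ^^ Suc k) z - f0 z) has_field_derivative deriv f0 z0 ^ Suc k - deriv f0 z0) (at z0)"
        by (intro derivative_intros der holomorphic_derivI[OF f0 U z0U])
      then show "\<not> (\<lambda>z. (f0 ^^ Suc k) z - f0 z) constant_on C"
        by (rule not_constant_on_deriv) (use mult k C in auto)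
      show "C' \<subseteq> C" by (auto simp: C'_def)
      fix K assume K: "compact K" "K \<subseteq> C'"
      then have KC: "K \<subseteq> C" by (auto simp: C'_def)
      have lim1: "uniform_limit K f f0 sequentially"
        using conv[OF K(1)] KC CU by auto
      show "uniform_limit K (\<lambda>n z. (f n ^^ Suc k) z - f n z) (\<lambda>z. (f0 ^^ Suc k) z - f0 z) sequentially"
        by (intro uniform_limit_intros lim[OF K(1) KC] lim1)
      obtain m where m: "m > 0" "\<forall>\<^sub>F n in sequentially. \<forall>z\<in>K. norm (f n z - z0) > m"
      proof (rule uniform_limit_eventually_avoids[OF lim1 K(1)])
        show "continuous_on K f0" using cont KC by (rule continuous_on_subset)
        show "f0 z \<noteq> z0" if "z \<in> K" for z using K that by (auto simp: C'_def)
      qed (rule that)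
      show "\<forall>\<^sub>F n in sequentially. (\<lambda>z. (f n ^^ Suc k) z - f n z) holomorphic_on K \<and>
          (\<forall>z\<in>K. (f n ^^ Suc k) z - f n z \<noteq> 0)"
        using cov[OF K(1) KC] m(2)
      proof eventually_elim
        case (elim n)
        then have inU: "(f n ^^ j) z \<in> U" if "z \<in> K" for j z
          using basin(5)[of z n j] that by blast
        then have "(f n ^^ Suc k) holomorphic_on K"
          by (intro holomorphic_iterate[OF f]) auto
        moreover have "f n holomorphic_on K"
          using f KC CU by (meson holomorphic_on_subset order_trans)
        moreover have "(f n ^^ Suc k) z \<noteq> f n z" if "z \<in> K" for z
        proof
          assume "(f n ^^ Suc k) z = f n z"
          then have "f n z = z0"
            using elim(1) that by (intro attracting_basin_periodic[OF U f att _ k]) auto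
          with elim(2) that m(1) show False by fastforce
        qed
        ultimately show ?case
          by (auto intro!: holomorphic_intros simp: o_def)
      qed
    qed
    then show ?thesis by simp
  qed
  have no_fix: "f0 z \<noteq> z" if "z \<in> C'" for z
    using periodic[OF that, of 1] by auto
  \<comment> \<open>The value \<open>0\<close> would make \<open>z\<close> periodic, and the value \<open>1\<close> would make \<open>f0 z\<close> periodic.\<close>
  define g where "g k = (\<lambda>z. ((f0 ^^ Suc (Suc k)) z - z) / (f0 z - z))" for k
  note A0 = immediate_basin_basics[OF fatou]
  have bd0: "bounded_on_compacts (range (\<lambda>n. f0 ^^ n)) (immediate_basin z0 f0 U)"
    by (rule immediate_basin_bounded[of z0 f0, OF fatou fz0 f0])
  have "\<exists>w. w \<in> C' \<inter> immediate_basin z0 f0 U"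
  proof (rule ccontr)
    assume *: "\<nexists>w. w \<in> C' \<inter> immediate_basin z0 f0 U"
    have "(\<lambda>z. f0 z - z0) constant_on (C \<inter> immediate_basin z0 f0 U)"
      unfolding constant_on_def using * by (intro exI[of _ 0]) (auto simp: C'_def)
    moreover have "\<not> (\<lambda>z. f0 z - z0) constant_on (C \<inter> immediate_basin z0 f0 U)"
      by (rule not_constant_on_deriv[OF der0 mult(1)]) (use C A0 in auto)
    ultimately show False by simp
  qed
  then obtain w where w: "w \<in> C'" "w \<in> immediate_basin z0 f0 U" by blast
  have "{w} \<subseteq> immediate_basin z0 f0 U" using w by simp
  then obtain B where B: "\<And>h z. h \<in> range (\<lambda>n. f0 ^^ n) \<Longrightarrow> z \<in> {w} \<Longrightarrow> norm (h z) \<le> B"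
    by (rule bounded_on_compactsE[OF bd0 compact_sing]) (rule that)
  have Bw: "norm ((f0 ^^ n) w) \<le> B" for n
    using B[of "f0 ^^ n" w] by blast
  have "bounded_on_compacts (range g) C'"
  proof (rule omits_0_1_bounded[OF C'_open C'_conn w(1)])
    fix h assume "h \<in> range g"
    then obtain k where k: "h = g k" by blast
    show "h holomorphic_on C'"
      unfolding k g_def using no_fix
      by (intro holomorphic_intros holomorphic_on_subset[OF hol] holomorphic_on_subset[OF hol0])
         (auto simp: C'_def)
    have "norm (h w) = norm ((f0 ^^ Suc (Suc k)) w - w) / norm (f0 w - w)"
      unfolding k g_def by (simp add: norm_divide)
    also have "\<dots> \<le> (B + norm w) / norm (f0 w - w)"
      using Bw[of "Suc (Suc k)"] norm_triangle_ineq4[of "(f0 ^^ Suc (Suc k)) w" w]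
      by (intro divide_right_mono) auto
    finally show "norm (h w) \<le> (B + norm w) / norm (f0 w - w)" .
    fix z assume z: "z \<in> C'"
    have "(f0 ^^ Suc (Suc k)) z \<noteq> z"
    proof
      assume "(f0 ^^ Suc (Suc k)) z = z"
      then have "(f0 ^^ Suc (Suc (Suc k))) z = f0 z" by simp
      with periodic[OF z, of "Suc (Suc k)"] show False by simp
    qed
    moreover have "(f0 ^^ Suc (Suc k)) z \<noteq> f0 z"
      using periodic[OF z, of "Suc k"] by simp
    ultimately show "h z \<noteq> 0 \<and> h z \<noteq> 1"
      unfolding k g_def using no_fix[OF z] by simp
  qed
  have bdC': "bounded_on_compacts (range (\<lambda>n. f0 ^^ n)) C'"
    unfolding bounded_on_compacts_def
  proof (intro allI impI)
    fix K assume K: "compact K" "K \<subseteq> C'"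
    obtain M where M: "M > 0" "\<And>h z. h \<in> range g \<Longrightarrow> z \<in> K \<Longrightarrow> norm (h z) \<le> M"
      by (rule bounded_on_compactsE[OF \<open>bounded_on_compacts (range g) C'\<close> K]) (rule that)
    have KC: "K \<subseteq> C" using K by (auto simp: C'_def)
    have "compact (f0 ` K)"
      using K cont KC by (intro compact_continuous_image) (auto intro: continuous_on_subset)
    then obtain B1 where B1: "\<And>z. z \<in> f0 ` K \<Longrightarrow> norm z \<le> B1"
      using compact_imp_bounded bounded_iff by metis
    obtain B2 where B2: "\<And>z. z \<in> K \<Longrightarrow> norm z \<le> B2"
      using compact_imp_bounded[OF K(1)] bounded_iff by metis
    have "norm ((f0 ^^ n) z) \<le> B2 + B1 + (B1 + B2) * M" if z: "z \<in> K" for n z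
    proof -
      have b: "norm z \<le> B2" "norm (f0 z) \<le> B1" using z B1 B2 by auto
      then have b0: "0 \<le> B2" "0 \<le> B1" using norm_ge_zero order_trans by blast+
      then have b1: "0 \<le> (B1 + B2) * M" using M(1) by simp
      consider "n = 0" | "n = 1" | k where "n = Suc (Suc k)"
        by (metis One_nat_def not0_implies_Suc)
      then show ?thesis
      proof cases
        case 3
        have "(f0 ^^ n) z = z + (f0 z - z) * g k z"
          using no_fix[of z] z K 3 unfolding g_def by auto
        also have "norm \<dots> \<le> norm z + norm (f0 z - z) * norm (g k z)"
          by (metis norm_triangle_ineq norm_mult)
        also have "\<dots> \<le> B2 + (B1 + B2) * M"
          using b M z norm_triangle_ineq4[of "f0 z" z] b0 by (intro add_mono mult_mono) auto
        finally show ?thesis using b0 by simp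
      qed (use b b0 b1 in auto)
    qed
    then show "\<exists>B. \<forall>h\<in>range (\<lambda>n. f0 ^^ n). \<forall>z\<in>K. norm (h z) \<le> B" by blast
  qed
  have "C' \<subseteq> fatou_set f0 U"
    using iter_U by (intro bounded_imp_subset_fatou_set[OF f0 C'_open _ bdC']) (auto simp: C'_def)
  moreover
  \<comment> \<open>The points with \<open>f0 z = z0\<close> are mapped into the Siegel disk, where the iterates are bounded.\<close>
  define V where "V = C \<inter> f0 -` immediate_basin z0 f0 U"
  have "V \<subseteq> fatou_set f0 U"
  proof (rule bounded_imp_subset_fatou_set[OF f0])
    show "open V" unfolding V_def by (intro continuous_open_preimage cont C A0(1))
    show "(f0 ^^ n) z \<in> U" if "z \<in> V" for z n using that iter_U by (auto simp: V_def)
    show "bounded_on_compacts (range (\<lambda>n. f0 ^^ n)) V"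
      unfolding bounded_on_compacts_def
    proof (intro allI impI)
      fix K assume K: "compact K" "K \<subseteq> V"
      have "compact (f0 ` K)"
        using K cont by (intro compact_continuous_image) (auto intro: continuous_on_subset simp: V_def)
      moreover have "f0 ` K \<subseteq> immediate_basin z0 f0 U" using K by (auto simp: V_def)
      ultimately obtain B1 where B1: "\<And>h z. h \<in> range (\<lambda>n. f0 ^^ n) \<Longrightarrow> z \<in> f0 ` K \<Longrightarrow> norm (h z) \<le> B1"
        by (rule bounded_on_compactsE[OF bd0]) (rule that)
      obtain B2 where B2: "\<And>z. z \<in> K \<Longrightarrow> norm z \<le> B2"
        using compact_imp_bounded[OF K(1)] bounded_iff by metis
      have "norm ((f0 ^^ n) z) \<le> max B1 B2" if z: "z \<in> K" for n z
      proof (cases n)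
        case 0
        then show ?thesis using B2[OF z] by simp
      next
        case (Suc m)
        then have "(f0 ^^ n) z = (f0 ^^ m) (f0 z)" by (simp add: funpow_swap1)
        then show ?thesis using B1[of "f0 ^^ m" "f0 z"] z by auto
      qed
      then show "\<exists>B. \<forall>h\<in>range (\<lambda>n. f0 ^^ n). \<forall>z\<in>K. norm (h z) \<le> B" by blast
    qed
  qed
  moreover have "C \<subseteq> C' \<union> V"
    using A0(3) by (auto simp: C'_def V_def)
  ultimately show ?thesis by blast
qed

section \<open>Irrational rotations\<close>

text \<open>
  Kronecker's approximation theorem, written multiplicatively.
\<close>

lemma rotation_orbit_dense:
  fixes \<rho> :: complex
  assumes "norm \<rho> = 1" "\<And>k. k \<ge> 1 \<Longrightarrow> \<rho> ^ k \<noteq> 1" "norm \<mu> = 1" "e > 0"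
  obtains k where "norm (\<rho> ^ k - \<mu>) < e"
proof -
  define E :: "real \<Rightarrow> complex" where "E x = cis (2 * pi * x)" for x
  have E_mult: "E x ^ k = E (real k * x)" for x k
  proof -
    have "real k * (2 * pi * x) = 2 * pi * (real k * x)" by simp
    then show ?thesis unfolding E_def by (metis Complex.DeMoivre)
  qed
  have E_int: "E (x + of_int m) = E x" for x m
    by (simp add: E_def distrib_left flip: cis_mult) 
  have E_surj: "\<exists>x. E x = z" if "norm z = 1" for z
  proof -
    have "z \<noteq> 0" using that by auto
    then have "E (Arg z / (2 * pi)) = z"
      using that by (simp add: E_def cis_Arg sgn_div_norm)
    then show ?thesis by blast
  qed
  obtain \<theta> \<alpha>' where \<theta>: "E \<theta> = \<rho>" and \<alpha>': "E \<alpha>' = \<mu>"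
    using E_surj assms by metis
  define \<alpha> where "\<alpha> = frac \<alpha>'"
  have \<alpha>: "E \<alpha> = \<mu>" "0 \<le> \<alpha>" "\<alpha> \<le> 1"
    using E_int[of "frac \<alpha>'" "\<lfloor>\<alpha>'\<rfloor>"] \<alpha>' frac_lt_1[of \<alpha>'] by (auto simp: \<alpha>_def frac_def)
  have irr: "\<theta> \<notin> \<rat>"
  proof
    assume "\<theta> \<in> \<rat>"
    then obtain p q :: int where pq: "q > 0" "\<theta> = of_int p / of_int q"
      by (metis Rats_cases')
    then have "\<rho> ^ nat q = E (of_int p)"
      using \<theta> E_mult[of \<theta> "nat q"] by simp
    also have "\<dots> = 1"
      using E_int[of 0 p] by (simp add: E_def)
    finally show False using assms(2)[of "nat q"] pq by simp
  qed
  have "continuous_on UNIV E"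
    unfolding E_def cis_conv_exp by (intro continuous_intros)
  then have "continuous (at \<alpha>) E"
    by (simp add: continuous_on_eq_continuous_at)
  then obtain d where d: "d > 0" "\<And>x. dist x \<alpha> < d \<Longrightarrow> dist (E x) (E \<alpha>) < e"
    using \<open>e > 0\<close> unfolding continuous_at_eps_delta by blast
  obtain k where k: "k > 0" "\<bar>frac (real k * \<theta>) - \<alpha>\<bar> < d"
    by (rule Kronecker_approx_1_explicit[OF irr \<alpha>(2,3) d(1)]) (rule that)
  have "dist (E (frac (real k * \<theta>))) (E \<alpha>) < e"
    using k by (intro d) (simp add: dist_real_def)
  moreover have "E (frac (real k * \<theta>)) = \<rho> ^ k"
    using E_int[of "frac (real k * \<theta>)" "\<lfloor>real k * \<theta>\<rfloor>"] E_mult[of \<theta> k] \<theta>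
    by (simp add: frac_def)
  ultimately show thesis
    using \<alpha>(1) by (intro that[of k]) (simp add: dist_norm)
qed

text \<open>
  In the power series of \<open>h\<close> the average multiplies the coefficient of \<open>w\<^sup>i\<close> by the mean of the powers of
  \<open>\<rho>\<^sup>i\<^sup>-\<^sup>j\<close>, which is \<open>1\<close> for \<open>i = j\<close> and tends to \<open>0\<close> otherwise, being a geometric sum divided by \<open>N\<close>. The
  Cauchy bounds on the coefficients allow Tannery's theorem to sum these limits, and they depend on \<open>h\<close>
  only through its bound \<open>M\<close>; this is why one sequence \<open>s\<close> serves all functions \<open>h\<close>.
\<close>

lemma rotation_averages_converge:
  fixes \<rho> :: complex and j :: nat
  assumes \<rho>: "norm \<rho> = 1" "\<And>k. k \<ge> 1 \<Longrightarrow> \<rho> ^ k \<noteq> 1" and r: "0 \<le> r" "r < R"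
  obtains s :: "nat \<Rightarrow> real" where "s \<longlonglongrightarrow> 0"
    "\<And>N h M w. N \<ge> 1 \<Longrightarrow> h holomorphic_on ball 0 R \<Longrightarrow> \<forall>w\<in>ball 0 R. norm (h w) \<le> M \<Longrightarrow>
       norm w \<le> r \<Longrightarrow>
       norm ((\<Sum>k<N. inverse \<rho> ^ (j * k) * h (\<rho> ^ k * w)) / of_nat N
              - (deriv ^^ j) h 0 / fact j * w ^ j) \<le> M * s N"
proof -
  have \<rho>0: "\<rho> \<noteq> 0" using \<rho> by auto
  \<comment> \<open>An intermediate radius, as \<open>h\<close> need not extend continuously to the circle of radius \<open>R\<close>.\<close>
  define R' where "R' = (r + R) / 2"
  have R': "r < R'" "R' < R" "0 < R'" using r by (auto simp: R'_def)
  define q where "q = r / R'"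
  have q: "0 \<le> q" "q < 1" using r R' by (auto simp: q_def divide_simps)
  define \<mu> where "\<mu> i = inverse \<rho> ^ j * \<rho> ^ i" for i :: nat
  have norm_\<mu>: "norm (\<mu> i) = 1" for i
    by (simp add: \<mu>_def norm_mult norm_power norm_inverse \<rho>)
  have \<mu>1: "\<mu> i \<noteq> 1" if "i \<noteq> j" for i
  proof (cases "i > j")
    case True
    then have "\<mu> i = \<rho> ^ (i - j)"
      using \<rho>0 by (simp add: \<mu>_def power_diff field_simps)
    then show ?thesis using \<rho>(2)[of "i - j"] True by simp
  next
    case False
    with that have "\<mu> i = inverse (\<rho> ^ (j - i))"
      using \<rho>0 by (simp add: \<mu>_def power_diff field_simps)
    then show ?thesis using \<rho>(2)[of "j - i"] False that by simp
  qed
  define m where "m i N = (if i = j then 0 else norm ((\<Sum>k<N. \<mu> i ^ k) / of_nat N))" for i N :: nat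
  have m_le: "0 \<le> m i N" "m i N \<le> 1" for i N
  proof -
    have "norm (\<Sum>k<N. \<mu> i ^ k) \<le> (\<Sum>k<N. norm (\<mu> i ^ k))" by (rule norm_sum)
    then have "norm (\<Sum>k<N. \<mu> i ^ k) \<le> real N" by (simp add: norm_power norm_\<mu>)
    then show "m i N \<le> 1" by (auto simp: m_def norm_divide divide_simps)
  qed (simp add: m_def)
  have m_lim: "(\<lambda>N. m i N) \<longlonglongrightarrow> 0" for i
  proof (cases "i = j")
    case False
    show ?thesis
    proof (rule tendsto_sandwich[where f = "\<lambda>_. 0" and h = "\<lambda>N. 2 / norm (1 - \<mu> i) / real N"])
      show "\<forall>\<^sub>F N in sequentially. m i N \<le> 2 / norm (1 - \<mu> i) / real N"
      proof (intro always_eventually allI)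
        fix N
        have "norm (1 - \<mu> i ^ N) \<le> 2"
          using norm_triangle_ineq4[of 1 "\<mu> i ^ N"] by (simp add: norm_power norm_\<mu>)
        then show "m i N \<le> 2 / norm (1 - \<mu> i) / real N"
          using False \<mu>1[OF False]
          by (auto simp: m_def sum_gp_strict norm_divide norm_mult intro!: divide_right_mono)
      qed
      show "(\<lambda>N. 2 / norm (1 - \<mu> i) / real N) \<longlonglongrightarrow> 0"
        by (intro tendsto_divide_0[OF tendsto_const] filterlim_at_top_imp_at_infinity filterlim_real_sequentially)
    qed (auto simp: m_le)
  qed (simp add: m_def)
  define s where "s N = (\<Sum>i. q ^ i * m i N)" for N
  have sm: "summable (\<lambda>i. q ^ i * m i N)" for N
  proof (rule summable_comparison_test'[OF summable_geometric[of q], of 0])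
    show "norm (q ^ i * m i N) \<le> q ^ i" for i
      using q m_le[of i N] by (simp add: mult_left_le)
  qed (use q in auto)
  have s_lim: "s \<longlonglongrightarrow> 0"
  proof -
    have "(\<lambda>N. \<Sum>i. q ^ i * m i N) \<longlonglongrightarrow> (\<Sum>i. 0)"
    proof (rule conjunct2[OF conjunct2[OF tannerys_theorem[where M = "\<lambda>i. q ^ i"]]])
      show "(\<lambda>N. q ^ i * m i N) \<longlonglongrightarrow> 0" for i
        using m_lim by (intro tendsto_mult_right_zero)
      show "\<forall>\<^sub>F (i, N) in sequentially \<times>\<^sub>F sequentially. norm (q ^ i * m i N) \<le> q ^ i"
        using q m_le by (intro always_eventually) (auto simp: mult_left_le)
    qed (use q in \<open>auto intro: summable_geometric\<close>)
    then show ?thesis by (simp add: s_def[abs_def])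
  qed
  show thesis
  proof (rule that[OF s_lim])
    fix N :: nat and h :: "complex \<Rightarrow> complex" and M :: real and w :: complex
    assume N: "N \<ge> 1" and h: "h holomorphic_on ball 0 R" "\<forall>w\<in>ball 0 R. norm (h w) \<le> M"
      and w: "norm w \<le> r"
    have "norm (h 0) \<le> M" using h(2) r by simp
    then have M0: "M \<ge> 0" using norm_ge_zero[of "h 0"] by linarith
    define a where "a i = (deriv ^^ i) h 0 / fact i" for i
    have a_le: "norm (a i) \<le> M / R' ^ i" for i
    proof -
      have "norm ((deriv ^^ i) h 0) \<le> fact i * M / R' ^ i"
      proof (rule Cauchy_inequality)
        show "h holomorphic_on ball 0 R'"
          using h(1) by (rule holomorphic_on_subset) (use R' in auto)
        have "h holomorphic_on cball 0 R'"
          using h(1) by (rule holomorphic_on_subset) (use R' in auto)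
        then show "continuous_on (cball 0 R') h"
          by (rule holomorphic_on_imp_continuous_on)
      qed (use R' h(2) in auto)
      then show ?thesis
        by (simp add: a_def norm_divide field_simps)
    qed
    have h_sums: "(\<lambda>i. a i * v ^ i) sums h v" if "norm v \<le> r" for v
      using holomorphic_power_series[OF h(1), of v] that r by (simp add: a_def)
    have "(\<lambda>i. inverse \<rho> ^ (j * k) * (a i * (\<rho> ^ k * w) ^ i)) sums (inverse \<rho> ^ (j * k) * h (\<rho> ^ k * w))" for k
      using w by (intro sums_mult h_sums) (simp add: norm_mult norm_power \<rho>)
    then have "(\<lambda>i. \<Sum>k<N. inverse \<rho> ^ (j * k) * (a i * (\<rho> ^ k * w) ^ i)) sums
               (\<Sum>k<N. inverse \<rho> ^ (j * k) * h (\<rho> ^ k * w))"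
      by (intro sums_sum)
    then have "(\<lambda>i. (\<Sum>k<N. inverse \<rho> ^ (j * k) * (a i * (\<rho> ^ k * w) ^ i)) / of_nat N) sums
               ((\<Sum>k<N. inverse \<rho> ^ (j * k) * h (\<rho> ^ k * w)) / of_nat N)"
      by (rule sums_divide)
    moreover have "(\<Sum>k<N. inverse \<rho> ^ (j * k) * (a i * (\<rho> ^ k * w) ^ i)) / of_nat N
        = a i * w ^ i * ((\<Sum>k<N. \<mu> i ^ k) / of_nat N)" for i
    proof -
      have "inverse \<rho> ^ (j * k) * (a i * (\<rho> ^ k * w) ^ i) = a i * w ^ i * \<mu> i ^ k" for k
        by (simp add: \<mu>_def power_mult_distrib power_mult[symmetric] mult_ac)
      then show ?thesis
        unfolding times_divide_eq_right sum_distrib_left by metis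
    qed
    ultimately have "(\<lambda>i. a i * w ^ i * ((\<Sum>k<N. \<mu> i ^ k) / of_nat N)) sums
               ((\<Sum>k<N. inverse \<rho> ^ (j * k) * h (\<rho> ^ k * w)) / of_nat N)"
      by simp
    from sums_diff[OF this sums_single[of j "\<lambda>i. a i * w ^ i"]]
    have main: "(\<lambda>i. a i * w ^ i * ((\<Sum>k<N. \<mu> i ^ k) / of_nat N) - (if i = j then a i * w ^ i else 0)) sums
       ((\<Sum>k<N. inverse \<rho> ^ (j * k) * h (\<rho> ^ k * w)) / of_nat N - a j * w ^ j)" .
    have bound: "norm (a i * w ^ i * ((\<Sum>k<N. \<mu> i ^ k) / of_nat N) - (if i = j then a i * w ^ i else 0))
         \<le> M * (q ^ i * m i N)" for i
    proof (cases "i = j")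
      case True
      have "\<mu> j = 1" using \<rho>0 by (simp add: \<mu>_def power_inverse)
      then show ?thesis using True N by (simp add: m_def)
    next
      case False
      have "norm (a i) * norm w ^ i \<le> M / R' ^ i * r ^ i"
        using a_le w M0 R' by (intro mult_mono power_mono) auto
      also have "\<dots> = M * q ^ i" by (simp add: q_def power_divide)
      finally have "norm (a i * w ^ i) \<le> M * q ^ i" by (simp add: norm_mult norm_power)
      then have "norm (a i * w ^ i) * m i N \<le> M * q ^ i * m i N"
        by (intro mult_right_mono m_le)
      then show ?thesis
        by (simp only: m_def False if_False diff_zero norm_mult mult.assoc)
    qed
    have "norm (\<Sum>i. a i * w ^ i * ((\<Sum>k<N. \<mu> i ^ k) / of_nat N) - (if i = j then a i * w ^ i else 0))
        \<le> (\<Sum>i. M * (q ^ i * m i N))"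
      by (rule norm_suminf_le[OF bound]) (intro summable_mult sm)
    also have "\<dots> = M * s N"
      unfolding s_def by (rule suminf_mult[OF sm])
    finally show "norm ((\<Sum>k<N. inverse \<rho> ^ (j * k) * h (\<rho> ^ k * w)) / of_nat N
              - (deriv ^^ j) h 0 / fact j * w ^ j) \<le> M * s N"
      using sums_unique[OF main] by (simp add: a_def)
  qed
qed

section \<open>Linearization of a rotation domain\<close>

text \<open>
  What is used of a Siegel disk: an invariant domain with bounded orbits around an irrationally neutral
  fixed point.
\<close>

locale rotation_domain =
  fixes f :: "complex \<Rightarrow> complex" and A :: "complex set" and z0 \<rho> :: complex
  assumes open_A: "open A" and connected_A: "connected A" and z0_in_A: "z0 \<in> A"
    and holo: "f holomorphic_on A" and invariant: "f ` A \<subseteq> A"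
    and fixpoint: "f z0 = z0" and multiplier: "deriv f z0 = \<rho>"
    and norm_multiplier: "norm \<rho> = 1" and irrational: "\<And>k. k \<ge> 1 \<Longrightarrow> \<rho> ^ k \<noteq> 1"
    and bounded_iterates: "bounded_on_compacts (range (\<lambda>n. f ^^ n)) A"
begin

lemma multiplier_nz: "\<rho> \<noteq> 0"
  using norm_multiplier by auto

lemma iterate_in_A: "z \<in> A \<Longrightarrow> (f ^^ n) z \<in> A"
  using invariant by (induction n) auto

lemma iterate_holo: "(f ^^ n) holomorphic_on A"
  by (rule holomorphic_iterate[OF holo]) (rule iterate_in_A)

text \<open>
  Its limit as \<open>N \<rightarrow> \<infinity>\<close> is the component of the identity (minus \<open>z0\<close>) in the eigenspace of
  \<open>u \<mapsto> u \<circ> f\<close> with eigenvalue \<open>\<rho>\<^sup>j\<close>; in a linearizing coordinate it is the \<open>j\<close>-th term of a power series.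
\<close>

definition avg :: "nat \<Rightarrow> nat \<Rightarrow> complex \<Rightarrow> complex" where
  "avg j N z = (\<Sum>k<N. inverse \<rho> ^ (j * k) * ((f ^^ k) z - z0)) / of_nat N"

lemma avg_holo: "avg j N holomorphic_on A"
proof -
  have "(\<lambda>z. (\<Sum>k<N. inverse \<rho> ^ (j * k) * ((f ^^ k) z - z0)) * inverse (of_nat N)) holomorphic_on A"
    by (intro holomorphic_intros iterate_holo)
  then show ?thesis by (simp add: avg_def[abs_def] divide_inverse)
qed

lemma avg_bound:
  assumes "\<And>k. norm ((f ^^ k) z - z0) \<le> M"
  shows "norm (avg j N z) \<le> M"
proof (cases "N = 0")
  case True
  then show ?thesis using assms[of 0] norm_ge_zero by (simp add: avg_def) (meson order_trans norm_ge_zero)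
next
  case False
  have "norm (\<Sum>k<N. inverse \<rho> ^ (j * k) * ((f ^^ k) z - z0)) \<le> (\<Sum>k<N. M)"
    by (rule order.trans[OF norm_sum])
       (intro sum_mono, simp add: norm_mult norm_power norm_inverse norm_multiplier assms)
  then show ?thesis
    using False by (simp add: avg_def norm_divide divide_simps mult.commute)
qed

lemma orbit_bound:
  assumes "z \<in> A"
  obtains M where "\<And>k. norm ((f ^^ k) z - z0) \<le> M"
proof -
  have "{z} \<subseteq> A" using assms by simp
  then obtain B where B: "\<And>h y. h \<in> range (\<lambda>n. f ^^ n) \<Longrightarrow> y \<in> {z} \<Longrightarrow> norm (h y) \<le> B"
    by (rule bounded_on_compactsE[OF bounded_iterates compact_sing]) (rule that)
  have "norm ((f ^^ k) z - z0) \<le> B + norm z0" for k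
    using B[of "f ^^ k" z] norm_triangle_ineq4[of "(f ^^ k) z" z0] by fastforce
  then show thesis by (rule that)
qed

lemma avg_bounded_on_compacts: "bounded_on_compacts (range (avg j)) A"
  unfolding bounded_on_compacts_def
proof (intro allI impI)
  fix K assume "compact K" "K \<subseteq> A"
  then obtain B where B: "\<And>h y. h \<in> range (\<lambda>n. f ^^ n) \<Longrightarrow> y \<in> K \<Longrightarrow> norm (h y) \<le> B"
    by (rule bounded_on_compactsE[OF bounded_iterates]) (rule that)
  have "norm ((f ^^ k) z - z0) \<le> B + norm z0" if "z \<in> K" for k z
    using B[of "f ^^ k" z] that norm_triangle_ineq4[of "(f ^^ k) z" z0] by fastforce
  then have "norm (avg j N z) \<le> B + norm z0" if "z \<in> K" for N z
    using that by (intro avg_bound)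
  then show "\<exists>B. \<forall>h\<in>range (avg j). \<forall>z\<in>K. norm (h z) \<le> B" by blast
qed

lemma avg_limit:
  obtains c r where "c holomorphic_on A" "strict_mono (r :: nat \<Rightarrow> nat)"
    "\<And>z. z \<in> A \<Longrightarrow> (\<lambda>n. avg j (r n) z) \<longlonglongrightarrow> c z"
    "\<And>K. compact K \<Longrightarrow> K \<subseteq> A \<Longrightarrow> uniform_limit K (\<lambda>n. avg j (r n)) c sequentially"
  by (rule Montel_subsequence[OF open_A avg_holo avg_bounded_on_compacts, of j]) (rule that)

text \<open>
  Composing an average with \<open>f\<close> shifts its terms by one step; this multiplies the average by \<open>\<rho>\<close> up to two
  boundary terms, which are bounded and divided by \<open>N\<close>.
\<close>

lemma eigenfunction:
  obtains \<phi> where "\<phi> holomorphic_on A" "\<phi> z0 = 0" "deriv \<phi> z0 = 1"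
    "\<And>z. z \<in> A \<Longrightarrow> \<phi> (f z) = \<rho> * \<phi> z"
proof -
  obtain \<phi> r where \<phi>: "\<phi> holomorphic_on A" "strict_mono (r :: nat \<Rightarrow> nat)"
    "\<And>z. z \<in> A \<Longrightarrow> (\<lambda>n. avg 1 (r n) z) \<longlonglongrightarrow> \<phi> z"
    "\<And>K. compact K \<Longrightarrow> K \<subseteq> A \<Longrightarrow> uniform_limit K (\<lambda>n. avg 1 (r n)) \<phi> sequentially"
    by (rule avg_limit[of 1]) (rule that)
  have r_pos: "\<forall>\<^sub>F n in sequentially. r n \<ge> 1"
    using eventually_ge_at_top[of 1] by eventually_elim (meson \<phi>(2) order_trans seq_suble)
  show thesis
  proof (rule that[OF \<phi>(1)])
    have "avg 1 n z0 = 0" for n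
      by (simp add: avg_def iterate_fixpoint fixpoint)
    then show "\<phi> z0 = 0"
      using \<phi>(3)[OF z0_in_A] by (simp add: LIMSEQ_const_iff)
  next
    obtain e where e: "e > 0" "cball z0 e \<subseteq> A"
      using open_A z0_in_A by (metis open_contains_cball)
    have der: "(avg 1 n has_field_derivative (\<Sum>k<n. inverse \<rho> ^ k * \<rho> ^ k) / of_nat n) (at z0)" for n
    proof -
      have d: "((f ^^ k) has_field_derivative \<rho> ^ k) (at z0)" for k
        using has_derivative_iterate_fixpoint[OF holo open_A z0_in_A fixpoint] multiplier by simp
      have "((\<lambda>z. (\<Sum>k<n. inverse \<rho> ^ (1 * k) * ((f ^^ k) z - z0)) / of_nat n) has_field_derivative
           (\<Sum>k<n. inverse \<rho> ^ (1 * k) * (\<rho> ^ k - 0)) / of_nat n) (at z0)"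
        by (intro DERIV_cdivide DERIV_sum DERIV_cmult DERIV_diff d DERIV_const)
      then show ?thesis by (simp add: avg_def[abs_def])
    qed
    have "(\<lambda>n. (deriv ^^ 1) (avg 1 (r n)) z0) \<longlonglongrightarrow> (deriv ^^ 1) \<phi> z0"
    proof (rule higher_deriv_complex_uniform_limit)
      show "uniform_limit (ball z0 e) (\<lambda>n. avg 1 (r n)) \<phi> sequentially"
        using \<phi>(4)[OF compact_cball e(2)] by (rule uniform_limit_on_subset) auto
      show "\<forall>\<^sub>F n in sequentially. avg 1 (r n) holomorphic_on ball z0 e"
        using avg_holo e(2) by (intro always_eventually allI) (meson ball_subset_cball holomorphic_on_subset)
    qed (use e in auto)
    moreover have "\<forall>\<^sub>F n in sequentially. (deriv ^^ 1) (avg 1 (r n)) z0 = 1"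
      using r_pos
    proof eventually_elim
      case (elim n)
      have "inverse \<rho> ^ k * \<rho> ^ k = 1" for k
        using multiplier_nz by (simp flip: power_mult_distrib)
      then show ?case using DERIV_imp_deriv[OF der, of "r n"] elim by simp
    qed
    then have "(\<lambda>n. (deriv ^^ 1) (avg 1 (r n)) z0) \<longlonglongrightarrow> 1"
      by (rule tendsto_eventually)
    ultimately have "(deriv ^^ 1) \<phi> z0 = 1" by (rule LIMSEQ_unique)
    then show "deriv \<phi> z0 = 1" by simp
  next
    fix z assume z: "z \<in> A"
    obtain M where M: "\<And>k. norm ((f ^^ k) z - z0) \<le> M"
      by (rule orbit_bound[OF z]) (rule that)
    have fz: "f z \<in> A" using invariant z by auto
    have diff: "norm (avg 1 N (f z) - \<rho> * avg 1 N z) \<le> 2 * M / real N" for N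
    proof -
      define b where "b k = inverse \<rho> ^ k * ((f ^^ k) z - z0)" for k
      have "inverse \<rho> ^ (1 * k) * ((f ^^ k) (f z) - z0) = \<rho> * b (Suc k)" for k
        using multiplier_nz by (simp add: b_def funpow_swap1 field_simps)
      then have "avg 1 N (f z) = \<rho> * (\<Sum>k<N. b (Suc k)) / of_nat N"
        by (simp add: avg_def sum_distrib_left)
      moreover have "avg 1 N z = (\<Sum>k<N. b k) / of_nat N"
        by (simp add: avg_def b_def)
      moreover have "(\<Sum>k<N. b (Suc k)) - (\<Sum>k<N. b k) = b N - b 0"
        by (simp add: sum_lessThan_telescope flip: sum_subtractf)
      ultimately have "avg 1 N (f z) - \<rho> * avg 1 N z = \<rho> * (b N - b 0) / of_nat N"
        by (metis diff_divide_distrib right_diff_distrib times_divide_eq_right)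
      moreover have "norm (b k) \<le> M" for k
        using M[of k] by (simp add: b_def norm_mult norm_power norm_inverse norm_multiplier)
      then have "norm (b N - b 0) \<le> 2 * M"
        using norm_triangle_ineq4[of "b N" "b 0"] by (smt (verit))
      ultimately show ?thesis
        by (simp add: norm_divide norm_mult norm_multiplier divide_right_mono)
    qed
    have "(\<lambda>n. avg 1 (r n) (f z) - \<rho> * avg 1 (r n) z) \<longlonglongrightarrow> \<phi> (f z) - \<rho> * \<phi> z"
      by (intro tendsto_intros \<phi>(3) fz z)
    moreover have "(\<lambda>n. avg 1 (r n) (f z) - \<rho> * avg 1 (r n) z) \<longlonglongrightarrow> 0"
    proof (rule Lim_null_comparison)
      show "\<forall>\<^sub>F n in sequentially. norm (avg 1 (r n) (f z) - \<rho> * avg 1 (r n) z) \<le> 2 * M / real (r n)"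
        using diff by simp
      have "(\<lambda>n. 2 * M / real n) \<longlonglongrightarrow> 0"
        by (intro tendsto_divide_0[OF tendsto_const] filterlim_at_top_imp_at_infinity filterlim_real_sequentially)
      then show "(\<lambda>n. 2 * M / real (r n)) \<longlonglongrightarrow> 0"
        by (rule filterlim_compose[OF _ filterlim_subseq[OF \<phi>(2)]])
    qed
    ultimately show "\<phi> (f z) = \<rho> * \<phi> z"
      using LIMSEQ_unique by fastforce
  qed
qed

text \<open>
  An eigenfunction with derivative \<open>1\<close> has a local inverse \<open>\<psi>\<close>, and \<open>\<psi>\<close> conjugates the rotation to \<open>f\<close> on a
  small disk. As the disk is invariant under the rotation, this extends to all iterates without shrinking
  it.
\<close>

lemma local_linearization:
  assumes \<phi>: "\<phi> holomorphic_on A" "\<phi> z0 = 0" "deriv \<phi> z0 = 1" "\<And>z. z \<in> A \<Longrightarrow> \<phi> (f z) = \<rho> * \<phi> z"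
  obtains \<psi> r R where "r > 0" "ball z0 r \<subseteq> A" "R > 0" "\<psi> holomorphic_on ball 0 R"
    "\<And>w. w \<in> ball 0 R \<Longrightarrow> \<psi> w \<in> ball z0 r"
    "\<And>z. z \<in> ball z0 r \<Longrightarrow> \<psi> (\<phi> z) = z"
    "\<And>w k. w \<in> ball 0 R \<Longrightarrow> (f ^^ k) (\<psi> w) = \<psi> (\<rho> ^ k * w)"
proof -
  obtain r where r: "r > 0" "ball z0 r \<subseteq> A" "inj_on \<phi> (ball z0 r)"
    using has_complex_derivative_locally_injective[OF \<phi>(1) z0_in_A open_A] \<phi>(3) by auto
  have hol: "\<phi> holomorphic_on ball z0 r" using \<phi>(1) r(2) by (rule holomorphic_on_subset)
  define V where "V = \<phi> ` ball z0 r"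
  obtain \<psi> where \<psi>: "\<psi> holomorphic_on V" "\<And>z. z \<in> ball z0 r \<Longrightarrow> \<psi> (\<phi> z) = z"
    using holomorphic_has_inverse[OF hol open_ball r(3)] unfolding V_def by metis
  have "open V" unfolding V_def by (rule open_mapping_thm3[OF hol open_ball r(3)])
  have "0 \<in> V" unfolding V_def using \<phi>(2) r(1) by (metis centre_in_ball imageI)
  have \<psi>0: "\<psi> 0 = z0" using \<psi>(2)[of z0] \<phi>(2) r(1) by simp
  have \<psi>V: "\<psi> w \<in> ball z0 r \<and> \<phi> (\<psi> w) = w" if "w \<in> V" for w
    using that \<psi>(2) unfolding V_def by auto
  have "continuous_on V (\<lambda>w. f (\<psi> w))"
  proof (rule continuous_on_compose2[of A f])
    show "continuous_on A f" using holo by (rule holomorphic_on_imp_continuous_on)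
    show "continuous_on V \<psi>" using \<psi>(1) by (rule holomorphic_on_imp_continuous_on)
    show "\<psi> ` V \<subseteq> A" using \<psi>V r(2) by blast
  qed
  then have "open (V \<inter> (\<lambda>w. f (\<psi> w)) -` ball z0 r)"
    using \<open>open V\<close> by (intro continuous_open_preimage) auto
  moreover have "0 \<in> V \<inter> (\<lambda>w. f (\<psi> w)) -` ball z0 r"
    using \<open>0 \<in> V\<close> \<psi>0 fixpoint r(1) by simp
  ultimately obtain R where R: "R > 0" "ball 0 R \<subseteq> V \<inter> (\<lambda>w. f (\<psi> w)) -` ball z0 r"
    by (meson open_contains_ball)
  have step1: "f (\<psi> w) = \<psi> (\<rho> * w)" if "w \<in> ball 0 R" for w
  proof -
    have w: "w \<in> V" "f (\<psi> w) \<in> ball z0 r" using R that by auto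
    then have "f (\<psi> w) = \<psi> (\<phi> (f (\<psi> w)))" using \<psi>(2) by simp
    also have "\<phi> (f (\<psi> w)) = \<rho> * w"
      using \<phi>(4)[of "\<psi> w"] \<psi>V[OF w(1)] r(2) by auto
    finally show ?thesis .
  qed
  have rot: "\<rho> ^ k * w \<in> ball 0 R" if "w \<in> ball 0 R" for w k
    using that by (simp add: norm_mult norm_power norm_multiplier)
  have iter: "(f ^^ k) (\<psi> w) = \<psi> (\<rho> ^ k * w)" if "w \<in> ball 0 R" for w k
  proof (induction k)
    case (Suc k)
    then show ?case using step1[OF rot[OF that, of k]] by (simp add: mult.assoc)
  qed simp
  show thesis
    by (rule that[of r R \<psi>]) (use r R \<psi> \<psi>V iter in \<open>auto intro: holomorphic_on_subset\<close>)
qed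

text \<open>
  The eigenfunction is a conjugacy from the whole domain onto a disk or the plane. Near \<open>z0\<close> the averages
  converge to \<open>b j * \<phi> z ^ j\<close>, where \<open>b j\<close> are the coefficients of the local inverse. The identity theorem
  carries this over to the whole domain, where it bounds \<open>b j * \<phi> z ^ j\<close> independently of \<open>j\<close>. So
  the power series of the local inverse converges on \<open>\<phi> ` A\<close> and inverts \<open>\<phi>\<close> there. Finally \<open>\<phi> ` A\<close> is
  open and invariant under multiplication by \<open>\<rho>\<close>, hence a union of circles around \<open>0\<close>, and connectedness
  leaves no gaps.
\<close>

lemma linearization:
  obtains \<phi> \<Psi> where "\<phi> holomorphic_on A" "\<phi> z0 = 0" "deriv \<phi> z0 = 1"
    "\<And>z. z \<in> A \<Longrightarrow> \<phi> (f z) = \<rho> * \<phi> z"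
    "\<Psi> holomorphic_on (\<phi> ` A)" "\<And>z. z \<in> A \<Longrightarrow> \<Psi> (\<phi> z) = z" "open (\<phi> ` A)"
    "\<And>w w'. w \<in> \<phi> ` A \<Longrightarrow> norm w' \<le> norm w \<Longrightarrow> w' \<in> \<phi> ` A"
    "\<And>w. w \<in> \<phi> ` A \<Longrightarrow> \<exists>w'\<in>\<phi> ` A. norm w' > norm w"
proof -
  obtain \<phi> where \<phi>: "\<phi> holomorphic_on A" "\<phi> z0 = 0" "deriv \<phi> z0 = 1"
    "\<And>z. z \<in> A \<Longrightarrow> \<phi> (f z) = \<rho> * \<phi> z"
    by (rule eigenfunction) (rule that)
  obtain \<psi> r R where loc: "r > 0" "ball z0 r \<subseteq> A" "R > 0" "\<psi> holomorphic_on ball 0 R"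
    "\<And>w. w \<in> ball 0 R \<Longrightarrow> \<psi> w \<in> ball z0 r"
    "\<And>z. z \<in> ball z0 r \<Longrightarrow> \<psi> (\<phi> z) = z"
    "\<And>w k. w \<in> ball 0 R \<Longrightarrow> (f ^^ k) (\<psi> w) = \<psi> (\<rho> ^ k * w)"
    by (rule local_linearization[OF \<phi>(1-3)]) (rule \<phi>(4), assumption, rule that)
  define h where "h w = \<psi> w - z0" for w
  define b where "b j = (deriv ^^ j) h 0 / fact j" for j
  have h_hol: "h holomorphic_on ball 0 R"
    unfolding h_def by (intro holomorphic_intros loc)
  have h_le: "norm (h w) \<le> r" if "w \<in> ball 0 R" for w
    using loc(5)[OF that] by (simp add: h_def dist_norm norm_minus_commute)
  define N where "N = {z \<in> ball z0 r. \<phi> z \<in> ball 0 (R/2)}"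
  have N_eq: "N = ball z0 r \<inter> \<phi> -` ball 0 (R/2)" by (auto simp: N_def)
  have "open N"
    unfolding N_eq using \<phi>(1) loc(2)
    by (intro continuous_open_preimage holomorphic_on_imp_continuous_on) (auto intro: holomorphic_on_subset)
  have "z0 \<in> N" using loc(1,3) \<phi>(2) by (simp add: N_def)
  have "N \<subseteq> A" using loc(2) by (auto simp: N_def)
  have coeff: "norm (b j * \<phi> z ^ j) \<le> M" if z: "z \<in> A" and M: "\<And>k. norm ((f ^^ k) z - z0) \<le> M" for j z M
  proof -
    obtain c s where c: "c holomorphic_on A" "strict_mono (s :: nat \<Rightarrow> nat)"
      "\<And>z. z \<in> A \<Longrightarrow> (\<lambda>n. avg j (s n) z) \<longlonglongrightarrow> c z"
      "\<And>K. compact K \<Longrightarrow> K \<subseteq> A \<Longrightarrow> uniform_limit K (\<lambda>n. avg j (s n)) c sequentially"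
      by (rule avg_limit[of j]) (rule that)
    have R2: "0 \<le> R/2" "R/2 < R" using loc(3) by auto
    obtain S :: "nat \<Rightarrow> real" where S: "S \<longlonglongrightarrow> 0"
      "\<And>N h M w. N \<ge> 1 \<Longrightarrow> h holomorphic_on ball 0 R \<Longrightarrow> \<forall>w\<in>ball 0 R. norm (h w) \<le> M \<Longrightarrow>
       norm w \<le> R/2 \<Longrightarrow>
       norm ((\<Sum>k<N. inverse \<rho> ^ (j * k) * h (\<rho> ^ k * w)) / of_nat N
              - (deriv ^^ j) h 0 / fact j * w ^ j) \<le> M * S N"
      by (rule rotation_averages_converge[OF norm_multiplier _ R2, of j]) (rule irrational, assumption, rule that)
    have near: "c y = b j * \<phi> y ^ j" if y: "y \<in> N" for y
    proof -
      have yA: "y \<in> A" using y \<open>N \<subseteq> A\<close> by blast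
      have w: "\<phi> y \<in> ball 0 R" "norm (\<phi> y) \<le> R/2" "\<psi> (\<phi> y) = y"
        using y loc(3,6) by (auto simp: N_def)
      have "avg j n y = (\<Sum>k<n. inverse \<rho> ^ (j * k) * h (\<rho> ^ k * \<phi> y)) / of_nat n" for n
        unfolding avg_def h_def using loc(7)[OF w(1)] w(3) by simp
      then have le: "norm (avg j n y - b j * \<phi> y ^ j) \<le> r * S n" if "n \<ge> 1" for n
        using S(2)[OF that h_hol _ w(2), of r] h_le by (simp add: b_def)
      have "(\<lambda>n. avg j n y - b j * \<phi> y ^ j) \<longlonglongrightarrow> 0"
      proof (rule Lim_null_comparison)
        show "\<forall>\<^sub>F n in sequentially. norm (avg j n y - b j * \<phi> y ^ j) \<le> r * S n"
          using eventually_ge_at_top[of 1] by eventually_elim (rule le)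
        show "(\<lambda>n. r * S n) \<longlonglongrightarrow> 0" by (rule tendsto_mult_right_zero[OF S(1)])
      qed
      then have "(\<lambda>n. avg j n y) \<longlonglongrightarrow> b j * \<phi> y ^ j" by (rule LIM_zero_cancel)
      then have "(\<lambda>n. avg j (s n) y) \<longlonglongrightarrow> b j * \<phi> y ^ j"
        by (rule filterlim_compose[OF _ filterlim_subseq[OF c(2)]])
      from LIMSEQ_unique[OF c(3)[OF yA] this] show ?thesis .
    qed
    have "c z = b j * \<phi> z ^ j"
    proof (rule analytic_continuation_open[OF \<open>open N\<close> open_A _ connected_A \<open>N \<subseteq> A\<close> c(1) _ near z])
      show "N \<noteq> {}" using \<open>z0 \<in> N\<close> by blast
      show "(\<lambda>y. b j * \<phi> y ^ j) holomorphic_on A" by (intro holomorphic_intros \<phi>)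
    qed
    moreover have "norm (c z) \<le> M"
      by (rule Lim_norm_ubound[OF sequentially_bot c(3)[OF z]]) (intro always_eventually allI avg_bound M)
    ultimately show ?thesis by simp
  qed
  define \<Psi> where "\<Psi> w = z0 + (\<Sum>j. b j * w ^ j)" for w
  have nc: "\<not> \<phi> constant_on A"
    using not_constant_on_deriv[OF holomorphic_derivI[OF \<phi>(1) open_A z0_in_A] _ open_A z0_in_A] \<phi>(3) by simp
  have open_D: "open (\<phi> ` A)"
    by (rule open_mapping_thm[OF \<phi>(1) open_A connected_A open_A order.refl nc])
  have larger: "\<exists>w'\<in>\<phi> ` A. norm w' > norm w" if w: "w \<in> \<phi> ` A" for w
  proof -
    obtain e where e: "e > 0" "cball w e \<subseteq> \<phi> ` A"
      using open_contains_cball[THEN iffD1, OF open_D] w by blast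
    show ?thesis
    proof (cases "w = 0")
      case True
      then show ?thesis using e by (intro bexI[of _ "of_real e"]) auto
    next
      case False
      define w' where "w' = w + of_real (e / norm w) * w"
      have "w' = of_real (1 + e / norm w) * w" by (simp add: w'_def algebra_simps)
      then have "norm w' = (1 + e / norm w) * norm w"
        using e(1) by (simp only: norm_mult norm_of_real) (simp add: abs_of_nonneg)
      also have "\<dots> = norm w + e" using False by (simp add: distrib_right)
      finally have "norm w' > norm w" using e(1) by simp
      moreover have "w' \<in> cball w e"
        using False e(1) by (simp add: w'_def dist_norm norm_mult norm_divide)
      ultimately show ?thesis using e(2) by blast
    qed
  qed
  have summ: "summable (\<lambda>j. b j * w ^ j)" if "w' \<in> \<phi> ` A" "norm w < norm w'" for w w'
  proof -
    obtain z where z: "z \<in> A" "w' = \<phi> z" using \<open>w' \<in> \<phi> ` A\<close> by blast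
    obtain M where M: "\<And>k. norm ((f ^^ k) z - z0) \<le> M"
      by (rule orbit_bound[OF z(1)]) (rule that)
    have w'0: "norm w' > 0" using that(2) norm_ge_zero[of w] by linarith
    show ?thesis
    proof (rule summable_comparison_test'[of "\<lambda>j. M * (norm w / norm w') ^ j" 0])
      show "summable (\<lambda>j. M * (norm w / norm w') ^ j)"
        using that(2) w'0 by (intro summable_mult summable_geometric) auto
      show "norm (b j * w ^ j) \<le> M * (norm w / norm w') ^ j" for j
      proof -
        have "norm (b j) * norm w' ^ j \<le> M"
          using coeff[OF z(1) M, of j] z(2) by (simp add: norm_mult norm_power)
        then have "norm (b j) * norm w' ^ j * (norm w / norm w') ^ j \<le> M * (norm w / norm w') ^ j"
          by (intro mult_right_mono) auto
        then show ?thesis using w'0 by (simp add: norm_mult norm_power power_divide)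
      qed
    qed
  qed
  have \<Psi>_hol: "\<Psi> holomorphic_on \<phi> ` A"
    unfolding holomorphic_on_open[OF open_D]
  proof
    fix w assume "w \<in> \<phi> ` A"
    then obtain w' where w': "w' \<in> \<phi> ` A" "norm w < norm w'" using larger by blast
    define t where "t = (norm w + norm w') / 2"
    have t: "norm w < t" "t < norm w'" "0 \<le> t" using w'(2) by (auto simp: t_def)
    have "summable (\<lambda>j. b j * of_real (t ^ j))"
      using summ[OF w'(1), of "of_real t"] t by simp
    from power_series_and_derivative_0[OF this] obtain g g' where g:
      "\<And>z. norm z < t \<Longrightarrow> (\<lambda>n. b n * z ^ n) sums g z \<and> (g has_field_derivative g' z) (at z)"
      by blast
    have "((\<lambda>z. z0 + g z) has_field_derivative 0 + g' w) (at w)"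
      using g[OF t(1)] by (intro derivative_intros) auto
    then have "(\<Psi> has_field_derivative 0 + g' w) (at w)"
    proof (rule has_field_derivative_transform_within_open[of _ _ _ "ball 0 t"])
      show "z0 + g z = \<Psi> z" if "z \<in> ball 0 t" for z
        using g[of z] that by (simp add: \<Psi>_def sums_iff)
    qed (use t in auto)
    then show "\<exists>f'. (\<Psi> has_field_derivative f') (at w)" by blast
  qed
  have inverse: "\<Psi> (\<phi> z) = z" if z: "z \<in> A" for z
  proof -
    have "(\<Psi> \<circ> \<phi>) z = id z"
    proof (rule analytic_continuation_open[OF \<open>open N\<close> open_A _ connected_A \<open>N \<subseteq> A\<close> _ _ _ z])
      show "N \<noteq> {}" using \<open>z0 \<in> N\<close> by blast
      show "(\<Psi> \<circ> \<phi>) holomorphic_on A"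
        by (rule holomorphic_on_compose_gen[OF \<phi>(1) \<Psi>_hol]) simp
      show "id holomorphic_on A" by (simp add: id_def)
      fix y assume y: "y \<in> N"
      have "\<phi> y \<in> ball 0 R" using y loc(3) by (auto simp: N_def)
      then have "(\<lambda>j. b j * \<phi> y ^ j) sums h (\<phi> y)"
        using holomorphic_power_series[OF h_hol, of "\<phi> y"] by (simp add: b_def)
      then have "\<Psi> (\<phi> y) = \<psi> (\<phi> y)"
        by (simp add: \<Psi>_def sums_iff h_def)
      then show "(\<Psi> \<circ> \<phi>) y = id y"
        using loc(6)[of y] y by (simp add: N_def)
    qed
    then show ?thesis by simp
  qed
  have rot_D: "\<rho> ^ k * w \<in> \<phi> ` A" if "w \<in> \<phi> ` A" for k w
  proof (induction k)
    case (Suc k)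
    then obtain z where "z \<in> A" "\<rho> ^ k * w = \<phi> z" by blast
    then have "\<rho> ^ Suc k * w = \<phi> (f z)" using \<phi>(4) by (simp add: mult.assoc)
    then show ?case using \<open>z \<in> A\<close> invariant by blast
  qed (use that in simp)
  have circle: "w' \<in> \<phi> ` A" if w: "w \<in> \<phi> ` A" and eq: "norm w' = norm w" for w w'
  proof (cases "w = 0")
    case True
    then show ?thesis using w eq by simp
  next
    case False
    obtain e where e: "e > 0" "ball w e \<subseteq> \<phi> ` A"
      using open_contains_ball[THEN iffD1, OF open_D] w by blast
    have nw: "norm (w' / w) = 1" "e / norm w > 0" using eq False e(1) by (simp_all add: norm_divide)
    obtain k where k: "norm (\<rho> ^ k - w' / w) < e / norm w"
      by (rule rotation_orbit_dense[OF norm_multiplier _ nw]) (rule irrational, assumption, rule that)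
    \<comment> \<open>Rotating \<open>w'\<close> back by \<open>k\<close> steps leads into the ball around \<open>w\<close>.\<close>
    define v where "v = inverse (\<rho> ^ k) * w'"
    have "w - v = inverse (\<rho> ^ k) * (w * (\<rho> ^ k - w' / w))"
      using False multiplier_nz by (simp add: v_def field_simps)
    then have "norm (w - v) = norm w * norm (\<rho> ^ k - w' / w)"
      by (simp add: norm_mult norm_inverse norm_power norm_multiplier)
    also have "\<dots> < e" using k False by (simp add: field_simps)
    finally have "v \<in> \<phi> ` A" using e(2) by (auto simp: dist_norm)
    moreover have "\<rho> ^ k * v = w'" using multiplier_nz by (simp add: v_def field_simps)
    ultimately show ?thesis using rot_D[of v k] by simp
  qed
  have disc: "w' \<in> \<phi> ` A" if w: "w \<in> \<phi> ` A" and le: "norm w' \<le> norm w" for w w'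
  proof (rule ccontr)
    assume w': "w' \<notin> \<phi> ` A"
    have "connected (\<phi> ` A)"
      using \<phi>(1) connected_A by (intro connected_continuous_image holomorphic_on_imp_continuous_on)
    moreover have "open {v. norm v < norm w'}" "open {v :: complex. norm w' < norm v}"
      by (intro open_Collect_less continuous_intros)+
    moreover have "0 \<in> \<phi> ` A" using \<phi>(2) z0_in_A by (metis imageI)
    moreover have "norm w' \<noteq> norm v" if "v \<in> \<phi> ` A" for v
      using circle[OF that, of w'] w' by blast
    moreover from this[OF w] le have "norm w' < norm w" by simp
    moreover from w' \<open>0 \<in> \<phi> ` A\<close> have "norm w' > 0" by (metis zero_less_norm_iff)
    ultimately show False
      using connectedD[of "\<phi> ` A" "{v. norm v < norm w'}" "{v. norm w' < norm v}"] w
      by (force simp: linorder_neq_iff)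
  qed
  show thesis
    by (rule that[OF \<phi> \<Psi>_hol inverse open_D disc larger])
qed

end

section \<open>Perturbation of an irrational rotation\<close>

lemma holomorphic_bounded_lipschitz:
  assumes h: "h holomorphic_on ball 0 r2" "\<And>w. w \<in> ball 0 r2 \<Longrightarrow> norm (h w) \<le> M"
    and r: "r < r2" and xy: "norm x \<le> r" "norm y \<le> r"
  shows "norm (h x - h y) \<le> 2 * M / (r2 - r) * norm (x - y)"
proof (rule field_differentiable_bound[OF convex_cball, of 0 r h "deriv h"])
  define d where "d = (r2 - r) / 2"
  have d: "d > 0" using r by (simp add: d_def)
  show "(h has_field_derivative deriv h z) (at z within cball 0 r)" if "z \<in> cball 0 r" for z
    using holomorphic_derivI[OF h(1) open_ball, of z] that r by simp
  show "norm (deriv h z) \<le> 2 * M / (r2 - r)" if z: "z \<in> cball 0 r" for z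
  proof -
    have sub: "cball z d \<subseteq> ball 0 r2"
    proof
      fix y assume "y \<in> cball z d"
      then have "norm y \<le> norm z + d"
        using norm_triangle_ineq[of z "y - z"] by (simp add: dist_norm norm_minus_commute)
      also have "\<dots> < r2" using z r by (simp add: d_def field_simps)
      finally show "y \<in> ball 0 r2" by simp
    qed
    have "norm ((deriv ^^ 1) h z) \<le> fact 1 * M / d ^ 1"
    proof (rule Cauchy_inequality)
      show "h holomorphic_on ball z d" "continuous_on (cball z d) h"
        using h(1) sub ball_subset_cball
        by (meson holomorphic_on_subset holomorphic_on_imp_continuous_on order_trans)+
      show "norm (h x) \<le> M" if "norm (z - x) = d" for x
        using that sub by (intro h(2)) (auto simp: dist_norm)
    qed (rule d)
    then show ?thesis by (simp add: d_def field_simps)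
  qed
qed (use xy in auto)

text \<open>
  With \<open>x = - \<epsilon> / \<rho>\<close>, the \<open>N\<close>-th iterate divided by \<open>\<rho>\<^sup>N\<close> is \<open>(1 - N x) w\<close> up to an error. It has one part
  linear in \<open>norm \<epsilon>\<close>, from replacing the average of \<open>\<rho>\<^sup>-\<^sup>j H(\<rho>\<^sup>j w)\<close> by \<open>w\<close>, and one part quadratic in
  \<open>norm \<epsilon>\<close>, from replacing the orbit of \<open>w\<close> by the rotation orbit. As \<open>Re x \<ge> c * norm \<epsilon>\<close>, the factor
  \<open>1 - N x\<close> gains \<open>N * c * norm \<epsilon>\<close>. First \<open>N\<close> is chosen such that the linear error costs at most half of this
  gain, then \<open>e\<close> such that the quadratic terms cost at most the other half. Both choices serve all \<open>H\<close> with the bound \<open>M\<close>.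
\<close>

lemma perturbed_rotation_preserves_disc:
  fixes \<rho> :: complex
  assumes \<rho>: "norm \<rho> = 1" "\<And>k. k \<ge> 1 \<Longrightarrow> \<rho> ^ k \<noteq> 1"
    and r: "0 < r1" "r1 < r2" and M: "M > 0" and c: "c > 0"
  obtains N e where "N \<ge> 1" "e > 0"
    "\<And>H \<epsilon> w. H holomorphic_on ball 0 r2 \<Longrightarrow> \<forall>w\<in>ball 0 r2. norm (H w) \<le> M \<Longrightarrow> deriv H 0 = 1 \<Longrightarrow>
       norm \<epsilon> < e \<Longrightarrow> Re (- \<epsilon> / \<rho>) \<ge> c * norm \<epsilon> \<Longrightarrow> norm w \<le> r1 \<Longrightarrow>
       (\<forall>j\<le>N. norm (((\<lambda>w. \<rho> * w + \<epsilon> * H w) ^^ j) w) < r2) \<and>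
       norm (((\<lambda>w. \<rho> * w + \<epsilon> * H w) ^^ N) w) \<le> r1"
proof -
  have \<rho>0: "\<rho> \<noteq> 0" using \<rho> by auto
  define R where "R = (r1 + r2) / 2"
  have R: "r1 < R" "R < r2" using r by (auto simp: R_def)
  define L where "L = 2 * M / (r2 - R)"
  have L: "L > 0" using M R by (simp add: L_def)
  have r0: "0 \<le> r1" using r by simp
  obtain S :: "nat \<Rightarrow> real" where S: "S \<longlonglongrightarrow> 0"
    "\<And>N h M w. N \<ge> 1 \<Longrightarrow> h holomorphic_on ball 0 r2 \<Longrightarrow> \<forall>w\<in>ball 0 r2. norm (h w) \<le> M \<Longrightarrow>
       norm w \<le> r1 \<Longrightarrow>
       norm ((\<Sum>k<N. inverse \<rho> ^ (1 * k) * h (\<rho> ^ k * w)) / of_nat N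
              - (deriv ^^ 1) h 0 / fact 1 * w ^ 1) \<le> M * S N"
    by (rule rotation_averages_converge[OF \<rho>(1) _ r0 r(2), of 1]) (rule \<rho>(2), assumption, rule that)
  have "\<forall>\<^sub>F N in sequentially. S N < r1 * c / (2 * M)"
    using S(1) r c M by (intro order_tendstoD(2)[OF S(1)]) simp
  then have "\<forall>\<^sub>F N in sequentially. S N < r1 * c / (2 * M) \<and> N \<ge> 1"
    using eventually_ge_at_top[of 1] by eventually_elim simp
  then obtain N where N: "S N < r1 * c / (2 * M)" "N \<ge> 1"
    using eventually_happens'[OF sequentially_bot] by blast
  have N0: "real N > 0" using N by simp
  define Q where "Q = r1 * (real N)\<^sup>2 / 2 + (real N)\<^sup>2 * L * M"
  have Q: "Q > 0" unfolding Q_def using r N0 L M by (intro add_pos_pos) auto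
  \<comment> \<open>The first bound keeps \<open>N\<close> steps inside radius \<open>R\<close>; the second makes the quadratic terms, at most \<open>Q * (norm \<epsilon>)\<^sup>2\<close>, cost at most half of the gain.\<close>
  define e where "e = min ((R - r1) / (real N * M)) (r1 * real N * c / 2 / Q)"
  have e: "e > 0" unfolding e_def using R N0 M r c Q by simp
  show thesis
  proof (rule that[OF N(2) e])
    fix H :: "complex \<Rightarrow> complex" and \<epsilon> w :: complex
    assume H: "H holomorphic_on ball 0 r2" "\<forall>w\<in>ball 0 r2. norm (H w) \<le> M" "deriv H 0 = 1"
      and \<epsilon>: "norm \<epsilon> < e" "Re (- \<epsilon> / \<rho>) \<ge> c * norm \<epsilon>" and w: "norm w \<le> r1"
    define F where "F = (\<lambda>w. \<rho> * w + \<epsilon> * H w)"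
    define t where "t = norm \<epsilon>"
    have t0: "t \<ge> 0" by (simp add: t_def)
    have "t \<le> (R - r1) / (real N * M)" using \<epsilon>(1) by (simp add: t_def e_def)
    then have t1: "real N * M * t \<le> R - r1" using N0 M by (simp add: field_simps)
    have "t \<le> r1 * real N * c / 2 / Q" using \<epsilon>(1) by (simp add: t_def e_def)
    then have t2: "Q * t \<le> r1 * real N * c / 2" using Q by (simp add: field_simps)
    have near: "norm ((F ^^ j) w - \<rho> ^ j * w) \<le> real j * M * t \<and> norm ((F ^^ j) w) \<le> R" if "j \<le> N" for j
      using that
    proof (induction j)
      case 0
      then show ?case using w R by simp
    next
      case (Suc j)
      then have IH: "norm ((F ^^ j) w - \<rho> ^ j * w) \<le> real j * M * t" "norm ((F ^^ j) w) \<le> R" by auto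
      have "(F ^^ Suc j) w - \<rho> ^ Suc j * w = \<rho> * ((F ^^ j) w - \<rho> ^ j * w) + \<epsilon> * H ((F ^^ j) w)"
        by (simp add: F_def algebra_simps)
      then have "norm ((F ^^ Suc j) w - \<rho> ^ Suc j * w) \<le> norm ((F ^^ j) w - \<rho> ^ j * w) + t * norm (H ((F ^^ j) w))"
        using norm_triangle_ineq[of "\<rho> * ((F ^^ j) w - \<rho> ^ j * w)" "\<epsilon> * H ((F ^^ j) w)"]
        by (simp add: norm_mult \<rho> t_def)
      also have "\<dots> \<le> real j * M * t + t * M"
        using IH H(2) R t0 by (intro add_mono mult_left_mono) auto
      finally have 1: "norm ((F ^^ Suc j) w - \<rho> ^ Suc j * w) \<le> real (Suc j) * M * t"
        by (simp add: algebra_simps)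
      have "real (Suc j) * (M * t) \<le> real N * (M * t)"
        using Suc.prems M t0 by (intro mult_right_mono) auto
      then have "norm ((F ^^ Suc j) w - \<rho> ^ Suc j * w) \<le> R - r1"
        using 1 t1 by (simp add: mult.assoc)
      moreover have "norm (\<rho> ^ Suc j * w) \<le> r1"
        using w by (simp only: norm_mult norm_power \<rho>) simp
      ultimately have "norm ((F ^^ Suc j) w) \<le> R"
        using norm_triangle_ineq[of "(F ^^ Suc j) w - \<rho> ^ Suc j * w" "\<rho> ^ Suc j * w"] by simp
      with 1 show ?case by blast
    qed
    have rot: "norm (\<rho> ^ j * w) \<le> r1" for j
      using w by (simp add: norm_mult norm_power \<rho>)
    have exact: "inverse \<rho> ^ n * (F ^^ n) w
        = w + \<epsilon> / \<rho> * (\<Sum>j<n. inverse \<rho> ^ j * H ((F ^^ j) w))" for n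
    proof (induction n)
      case (Suc n)
      have "inverse \<rho> ^ Suc n * (F ^^ Suc n) w
          = inverse \<rho> ^ n * (F ^^ n) w + \<epsilon> / \<rho> * (inverse \<rho> ^ n * H ((F ^^ n) w))"
        using \<rho>0 by (simp add: F_def field_simps)
      then show ?case unfolding Suc by (simp add: algebra_simps)
    qed simp
    define X where "X = (\<Sum>j<N. inverse \<rho> ^ j * H ((F ^^ j) w))"
    define Y where "Y = (\<Sum>j<N. inverse \<rho> ^ j * H (\<rho> ^ j * w))"
    have XY: "norm (X - Y) \<le> (real N)\<^sup>2 * L * M * t"
    proof -
      have "norm (X - Y) = norm (\<Sum>j<N. inverse \<rho> ^ j * (H ((F ^^ j) w) - H (\<rho> ^ j * w)))"
        by (simp add: X_def Y_def sum_subtractf algebra_simps)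
      also have "\<dots> \<le> (\<Sum>j<N. L * (real N * M * t))"
      proof (rule order.trans[OF norm_sum], rule sum_mono)
        fix j assume "j \<in> {..<N}"
        then have j: "j \<le> N" by simp
        have "norm (H ((F ^^ j) w) - H (\<rho> ^ j * w)) \<le> L * norm ((F ^^ j) w - \<rho> ^ j * w)"
          unfolding L_def
          by (rule holomorphic_bounded_lipschitz[OF H(1) _ R(2)]) (use H(2) near[OF j] rot[of j] R in auto)
        also have "\<dots> \<le> L * (real j * M * t)"
          using near[OF j] L by (intro mult_left_mono) auto
        also have "\<dots> \<le> L * (real N * M * t)"
          using j L M t0 by (intro mult_left_mono mult_right_mono) auto
        finally show "norm (inverse \<rho> ^ j * (H ((F ^^ j) w) - H (\<rho> ^ j * w))) \<le> L * (real N * M * t)"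
          by (simp add: norm_mult norm_power norm_inverse \<rho>)
      qed
      also have "\<dots> = (real N)\<^sup>2 * L * M * t" by (simp add: power2_eq_square)
      finally show ?thesis .
    qed
    have Yw: "norm (Y - of_nat N * w) \<le> real N * (r1 * c / 2)"
    proof -
      have "norm (Y / of_nat N - w) \<le> M * S N"
        using S(2)[OF N(2) H(1,2) w] H(3) by (simp add: Y_def)
      also have "\<dots> \<le> r1 * c / 2" using N(1) M by (simp add: field_simps)
      finally have "real N * norm (Y / of_nat N - w) \<le> real N * (r1 * c / 2)"
        by (intro mult_left_mono) auto
      moreover have "real N * norm (Y / of_nat N - w) = norm (of_nat N * (Y / of_nat N - w))"
        by (simp add: norm_mult)
      moreover have "of_nat N * (Y / of_nat N - w) = Y - of_nat N * w"
        using N0 by (simp add: right_diff_distrib)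
      ultimately show ?thesis by simp
    qed
    define x where "x = - \<epsilon> / \<rho>"
    have x: "norm x = t" "Re x \<ge> c * t" using \<epsilon>(2) by (simp_all add: x_def t_def norm_divide \<rho>)
    \<comment> \<open>From \<open>2 a \<le> 1 + a\<^sup>2\<close> for \<open>a = norm (1 - N x)\<close>, which avoids the square root.\<close>
    have contraction: "norm (1 - of_nat N * x) \<le> 1 - real N * c * t + (real N)\<^sup>2 * t\<^sup>2 / 2"
    proof -
      define a where "a = norm (1 - of_nat N * x)"
      have "a\<^sup>2 = (1 - real N * Re x)\<^sup>2 + (real N * Im x)\<^sup>2"
        by (simp add: a_def cmod_power2)
      also have "\<dots> = 1 - 2 * (real N * Re x) + (real N)\<^sup>2 * ((Re x)\<^sup>2 + (Im x)\<^sup>2)"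
        by (simp add: power2_eq_square algebra_simps)
      also have "(Re x)\<^sup>2 + (Im x)\<^sup>2 = t\<^sup>2" using x(1) by (metis cmod_power2)
      finally have "a\<^sup>2 = 1 - 2 * (real N * Re x) + (real N)\<^sup>2 * t\<^sup>2" .
      moreover have "real N * (c * t) \<le> real N * Re x" using x(2) by (intro mult_left_mono) auto
      moreover have "2 * a \<le> 1 + a\<^sup>2"
        using zero_le_power2[of "a - 1"] by (simp add: power2_eq_square algebra_simps)
      ultimately show ?thesis unfolding a_def[symmetric] by simp
    qed
    have "norm ((F ^^ N) w) = norm (inverse \<rho> ^ N * (F ^^ N) w)"
      by (simp add: norm_mult norm_power norm_inverse \<rho>)
    also have "inverse \<rho> ^ N * (F ^^ N) w = w - x * X"
      unfolding exact X_def by (simp add: x_def)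
    also have "w - x * X = (1 - of_nat N * x) * w - x * ((Y - of_nat N * w) + (X - Y))"
      by (simp add: algebra_simps)
    also have "norm \<dots> \<le> norm (1 - of_nat N * x) * norm w + t * (norm (Y - of_nat N * w) + norm (X - Y))"
    proof -
      have "norm ((1 - of_nat N * x) * w - x * ((Y - of_nat N * w) + (X - Y)))
          \<le> norm ((1 - of_nat N * x) * w) + norm (x * ((Y - of_nat N * w) + (X - Y)))"
        by (rule norm_triangle_ineq4)
      also have "\<dots> \<le> norm (1 - of_nat N * x) * norm w + t * (norm (Y - of_nat N * w) + norm (X - Y))"
        unfolding norm_mult x(1) by (intro add_left_mono mult_left_mono norm_triangle_ineq t0)
      finally show ?thesis .
    qed
    also have "\<dots> \<le> (1 - real N * c * t + (real N)\<^sup>2 * t\<^sup>2 / 2) * r1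
        + t * (real N * (r1 * c / 2) + (real N)\<^sup>2 * L * M * t)"
      using contraction order.trans[OF norm_ge_zero contraction] w XY Yw t0
      by (intro add_mono mult_mono mult_left_mono) auto
    also have "\<dots> = r1 - t * (r1 * real N * c / 2 - Q * t)"
      by (simp add: Q_def power2_eq_square algebra_simps)
    also have "\<dots> \<le> r1" using t0 t2 by simp
    finally have "norm ((F ^^ N) w) \<le> r1" .
    moreover have "norm ((F ^^ j) w) < r2" if "j \<le> N" for j
      using near[OF that] R by auto
    ultimately show "(\<forall>j\<le>N. norm (((\<lambda>w. \<rho> * w + \<epsilon> * H w) ^^ j) w) < r2) \<and>
       norm (((\<lambda>w. \<rho> * w + \<epsilon> * H w) ^^ N) w) \<le> r1"
      unfolding F_def by blast
  qed
qed

text \<open>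
  Between multiples of \<open>N\<close> an orbit may leave the disk of radius \<open>r1\<close>, but not the one of radius \<open>r2\<close>.
\<close>

lemma iterate_block_bound:
  fixes F :: "complex \<Rightarrow> complex"
  assumes "N \<ge> 1" "\<And>w. norm w \<le> r1 \<Longrightarrow> (\<forall>j\<le>N. norm ((F ^^ j) w) < r2) \<and> norm ((F ^^ N) w) \<le> (r1 :: real)"
    and "norm w \<le> r1"
  shows "norm ((F ^^ j) w) < r2"
proof -
  have block: "norm ((F ^^ (m * N)) w) \<le> r1" for m
  proof (induction m)
    case (Suc m)
    have "(F ^^ (Suc m * N)) w = (F ^^ N) ((F ^^ (m * N)) w)"
      by (simp add: funpow_add)
    then show ?case using assms(2)[OF Suc] by simp
  qed (use assms in simp)
  have "(F ^^ j) w = (F ^^ (j mod N)) ((F ^^ (j div N * N)) w)"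
    by (metis add.commute comp_apply div_mult_mod_eq funpow_add)
  moreover have "j mod N \<le> N" using assms(1) by (simp add: less_imp_le)
  ultimately show ?thesis using assms(2)[OF block, of "j div N"] by simp
qed

context rotation_domain
begin

text \<open>
  In the linearizing coordinate \<open>g n\<close> is the perturbed rotation \<open>w \<mapsto> \<rho> w + \<epsilon>\<^sub>n H(w)\<close>, where \<open>\<epsilon>\<^sub>n\<close> is the difference
  of the multipliers and the bound on the difference quotients bounds \<open>H\<close>. The
  orbits starting in the disk that it preserves stay in a slightly larger one, so the preimage of that disk
  under the coordinate is a connected set of bounded orbits that contains \<open>z0\<close> and \<open>K\<close>.
\<close>

lemma perturbation_basin_covers:
  fixes g :: "nat \<Rightarrow> complex \<Rightarrow> complex"
  assumes U: "open U" "A \<subseteq> U" and g: "\<And>n. g n holomorphic_on U" "\<And>n. g n z0 = z0"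
    and conv: "\<And>K. compact K \<Longrightarrow> K \<subseteq> U \<Longrightarrow> uniform_limit K g f sequentially"
    and c: "c > 0" "\<And>n. Re (1 - deriv (g n) z0 / \<rho>) \<ge> c * norm (1 - deriv (g n) z0 / \<rho>)"
    and ne: "\<And>n. deriv (g n) z0 \<noteq> \<rho>"
    and quot: "\<And>K. compact K \<Longrightarrow> K \<subseteq> U \<Longrightarrow>
           \<exists>M. \<forall>n. \<forall>z\<in>K. norm ((g n z - f z) / (deriv (g n) z0 - \<rho>)) \<le> M"
    and K: "compact K" "K \<subseteq> A"
  shows "\<forall>\<^sub>F n in sequentially. K \<subseteq> immediate_basin z0 (g n) U"
proof -
  obtain \<phi> \<Psi> where \<phi>: "\<phi> holomorphic_on A" "\<phi> z0 = 0" "deriv \<phi> z0 = 1"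
    "\<And>z. z \<in> A \<Longrightarrow> \<phi> (f z) = \<rho> * \<phi> z"
    and \<Psi>: "\<Psi> holomorphic_on (\<phi> ` A)" "\<And>z. z \<in> A \<Longrightarrow> \<Psi> (\<phi> z) = z"
    and D: "open (\<phi> ` A)" "\<And>w w'. w \<in> \<phi> ` A \<Longrightarrow> norm w' \<le> norm w \<Longrightarrow> w' \<in> \<phi> ` A"
    "\<And>w. w \<in> \<phi> ` A \<Longrightarrow> \<exists>w'\<in>\<phi> ` A. norm w' > norm w"
    by (rule linearization) (rule that)
  have \<Psi>A: "\<Psi> w \<in> A" "\<phi> (\<Psi> w) = w" "f (\<Psi> w) = \<Psi> (\<rho> * w)" if w: "w \<in> \<phi> ` A" for w
  proof -
    obtain z where z: "z \<in> A" "w = \<phi> z" using w by blast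
    show "\<Psi> w \<in> A" "\<phi> (\<Psi> w) = w" using z \<Psi>(2) by auto
    show "f (\<Psi> w) = \<Psi> (\<rho> * w)"
      using z \<Psi>(2)[of z] \<Psi>(2)[of "f z"] \<phi>(4)[of z] invariant by auto
  qed
  have cont\<phi>: "continuous_on A \<phi>" using \<phi>(1) by (rule holomorphic_on_imp_continuous_on)
  have zero_D: "0 \<in> \<phi> ` A" using \<phi>(2) z0_in_A by (metis imageI)
  obtain w0 where w0: "w0 \<in> \<phi> ` A" "\<And>z. z \<in> K \<Longrightarrow> norm (\<phi> z) \<le> norm w0"
  proof (cases "K = {}")
    case False
    have "continuous_on K (\<lambda>z. norm (\<phi> z))"
      using cont\<phi> K(2) by (intro continuous_intros) (rule continuous_on_subset)
    from continuous_attains_sup[OF K(1) False this] obtain x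
      where "x \<in> K" "\<And>y. y \<in> K \<Longrightarrow> norm (\<phi> y) \<le> norm (\<phi> x)" by blast
    then show thesis using K(2) by (intro that[of "\<phi> x"]) auto
  qed (use that[of 0] zero_D in auto)
  obtain w2 where w2: "w2 \<in> \<phi> ` A" "norm w0 < norm w2" using D(3)[OF w0(1)] by blast
  define r2 where "r2 = norm w2"
  define r1 where "r1 = (norm w0 + r2) / 2"
  have r: "0 < r1" "norm w0 < r1" "r1 < r2"
    using w2(2) norm_ge_zero[of w0] by (auto simp: r1_def r2_def simp del: norm_ge_zero)
  have disc: "cball 0 r2 \<subseteq> \<phi> ` A" using D(2)[OF w2(1)] by (auto simp: r2_def)
  define K2 where "K2 = \<Psi> ` cball 0 r2"
  have K2: "compact K2" "K2 \<subseteq> A"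
    unfolding K2_def using disc \<Psi>A(1)
    by (auto intro!: compact_continuous_image continuous_on_subset[OF holomorphic_on_imp_continuous_on[OF \<Psi>(1)]])
  have K2U: "K2 \<subseteq> U" using K2(2) U(2) by blast
  have fK2: "f z \<in> K2" if "z \<in> K2" for z
  proof -
    obtain w where w: "w \<in> cball 0 r2" "z = \<Psi> w" using \<open>z \<in> K2\<close> unfolding K2_def by blast
    have "\<rho> * w \<in> cball 0 r2" using w(1) by (simp add: norm_mult norm_multiplier)
    then show ?thesis using w \<Psi>A(3)[of w] disc unfolding K2_def by auto
  qed
  obtain e L where L: "e > 0" "compact L" "L \<subseteq> A" "\<And>x. x \<in> K2 \<Longrightarrow> cball x e \<subseteq> L"
    by (rule compact_closed_neighbourhood[OF K2(1) open_A K2(2)]) (rule that)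
  have "continuous_on L (deriv \<phi>)"
    using holomorphic_deriv[OF \<phi>(1) open_A] L(3)
    by (meson holomorphic_on_imp_continuous_on continuous_on_subset)
  then have "bounded (deriv \<phi> ` L)"
    using compact_continuous_image[OF _ L(2)] compact_imp_bounded by blast
  then obtain B where B: "B > 0" "\<And>x. x \<in> L \<Longrightarrow> norm (deriv \<phi> x) \<le> B"
    unfolding bounded_pos by auto
  have lip: "norm (\<phi> y - \<phi> x) \<le> B * norm (y - x)" if "x \<in> K2" "norm (y - x) \<le> e" for x y
  proof (rule field_differentiable_bound[OF convex_cball, of x e \<phi> "deriv \<phi>"])
    fix z assume z: "z \<in> cball x e"
    then have "z \<in> L" using L(4)[OF that(1)] by blast
    then show "norm (deriv \<phi> z) \<le> B" by (rule B)
    show "(\<phi> has_field_derivative deriv \<phi> z) (at z within cball x e)"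
      using \<open>z \<in> L\<close> L(3) by (intro holomorphic_derivI[OF \<phi>(1) open_A]) auto
  qed (use that L(1) in \<open>auto simp: dist_norm norm_minus_commute\<close>)
  obtain M0 where M0: "\<And>n z. z \<in> K2 \<Longrightarrow> norm ((g n z - f z) / (deriv (g n) z0 - \<rho>)) \<le> M0"
    using quot[OF K2(1) K2U] by blast
  define \<epsilon> where "\<epsilon> n = deriv (g n) z0 - \<rho>" for n
  have \<epsilon>0: "\<epsilon> n \<noteq> 0" for n using ne by (simp add: \<epsilon>_def)
  define M where "M = \<bar>B * M0\<bar> + 1"
  have M: "M > 0" by (simp add: M_def add_nonneg_pos)
  obtain N e' where N: "N \<ge> 1" "e' > 0"
    "\<And>H \<epsilon> w. H holomorphic_on ball 0 r2 \<Longrightarrow> \<forall>w\<in>ball 0 r2. norm (H w) \<le> M \<Longrightarrow> deriv H 0 = 1 \<Longrightarrow>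
       norm \<epsilon> < e' \<Longrightarrow> Re (- \<epsilon> / \<rho>) \<ge> c * norm \<epsilon> \<Longrightarrow> norm w \<le> r1 \<Longrightarrow>
       (\<forall>j\<le>N. norm (((\<lambda>w. \<rho> * w + \<epsilon> * H w) ^^ j) w) < r2) \<and>
       norm (((\<lambda>w. \<rho> * w + \<epsilon> * H w) ^^ N) w) \<le> r1"
    by (rule perturbed_rotation_preserves_disc[OF norm_multiplier _ r(1,3) M c(1)])
       (rule irrational, assumption, rule that)
  have "\<epsilon> \<longlonglongrightarrow> 0"
  proof -
    have z0U: "z0 \<in> U" using z0_in_A U(2) by blast
    obtain d where d: "d > 0" "cball z0 d \<subseteq> U" using U(1) z0U by (metis open_contains_cball)
    have "(\<lambda>n. (deriv ^^ 1) (g n) z0) \<longlonglongrightarrow> (deriv ^^ 1) f z0"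
    proof (rule higher_deriv_complex_uniform_limit)
      show "uniform_limit (ball z0 d) g f sequentially"
        using conv[OF compact_cball d(2)] by (rule uniform_limit_on_subset) auto
      show "\<forall>\<^sub>F n in sequentially. g n holomorphic_on ball z0 d"
        using g(1) d(2) by (intro always_eventually allI) (meson ball_subset_cball holomorphic_on_subset)
    qed (use d in auto)
    then have "(\<lambda>n. deriv (g n) z0) \<longlonglongrightarrow> \<rho>" by (simp add: multiplier)
    then show ?thesis unfolding \<epsilon>_def[abs_def] by (simp add: LIM_zero_iff)
  qed
  then have "\<forall>\<^sub>F n in sequentially. norm (\<epsilon> n) < e'"
    using N(2) by (auto simp: tendsto_iff)
  moreover have "\<forall>\<^sub>F n in sequentially. \<forall>z\<in>K2. dist (g n z) (f z) < e"
    by (rule uniform_limitD[OF conv[OF K2(1) K2U] L(1)])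
  ultimately show ?thesis
  proof eventually_elim
    case (elim n)
    define F where "F w = \<phi> (g n (\<Psi> w))" for w
    have close: "norm (g n z - f z) \<le> e" "g n z \<in> A" if "z \<in> K2" for z
    proof -
      show le: "norm (g n z - f z) \<le> e" using elim(2) that by (simp add: dist_norm less_imp_le)
      then have "g n z \<in> cball (f z) e" by (simp add: dist_norm norm_minus_commute)
      then show "g n z \<in> A" using L(3,4) fK2[OF that] by blast
    qed
    have \<Psi>K2: "\<Psi> w \<in> K2" if "w \<in> ball 0 r2" for w
      using that unfolding K2_def by auto
    have F_conj: "g n (\<Psi> w) = \<Psi> (F w)" if "w \<in> ball 0 r2" for w
      unfolding F_def using \<Psi>(2)[OF close(2)[OF \<Psi>K2[OF that]]] by simp
    have \<Psi>hol: "\<Psi> holomorphic_on ball 0 r2"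
      using \<Psi>(1) disc ball_subset_cball by (meson holomorphic_on_subset order_trans)
    have F_hol: "F holomorphic_on ball 0 r2"
    proof -
      have "(\<phi> \<circ> (g n \<circ> \<Psi>)) holomorphic_on ball 0 r2"
      proof (rule holomorphic_on_compose_gen[OF _ \<phi>(1)])
        show "(g n \<circ> \<Psi>) holomorphic_on ball 0 r2"
          using \<Psi>K2 K2U by (intro holomorphic_on_compose_gen[OF \<Psi>hol g(1)]) auto
        show "(g n \<circ> \<Psi>) ` ball 0 r2 \<subseteq> A"
          using close(2) \<Psi>K2 by auto
      qed
      then show ?thesis by (simp add: F_def[abs_def] o_def)
    qed
    define H where "H w = (F w - \<rho> * w) / \<epsilon> n" for w
    have F_eq: "F = (\<lambda>w. \<rho> * w + \<epsilon> n * H w)"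
      using \<epsilon>0 by (auto simp: H_def)
    have H_hol: "H holomorphic_on ball 0 r2"
      unfolding H_def using \<epsilon>0 by (intro holomorphic_intros F_hol) auto
    have H_le: "norm (H w) \<le> M" if w: "w \<in> ball 0 r2" for w
    proof -
      have wD: "w \<in> \<phi> ` A" using w disc by auto
      have "\<rho> * w = \<phi> (f (\<Psi> w))" using \<phi>(4)[OF \<Psi>A(1)[OF wD]] \<Psi>A(2)[OF wD] by simp
      then have "norm (F w - \<rho> * w) \<le> B * norm (g n (\<Psi> w) - f (\<Psi> w))"
        unfolding F_def using lip[OF fK2[OF \<Psi>K2[OF w]] close(1)[OF \<Psi>K2[OF w]]] by simp
      then have "norm (H w) \<le> B * norm ((g n (\<Psi> w) - f (\<Psi> w)) / \<epsilon> n)"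
        using divide_right_mono[of _ _ "norm (\<epsilon> n)"] by (fastforce simp: H_def norm_divide)
      also have "\<dots> \<le> B * M0"
        using M0[OF \<Psi>K2[OF w], of n] B(1) by (intro mult_left_mono) (auto simp: \<epsilon>_def)
      also have "\<dots> \<le> M" by (simp add: M_def)
      finally show ?thesis .
    qed
    have \<Psi>0: "\<Psi> 0 = z0" using \<Psi>(2)[OF z0_in_A] \<phi>(2) by simp
    have zero_ball: "0 \<in> ball 0 r2" using r by simp
    have der\<Psi>: "(\<Psi> has_field_derivative 1) (at 0)"
    proof -
      have d\<Psi>: "(\<Psi> has_field_derivative deriv \<Psi> 0) (at (\<phi> z0))"
        using holomorphic_derivI[OF \<Psi>(1) D(1) zero_D] \<phi>(2) by simp
      have d\<phi>: "(\<phi> has_field_derivative 1) (at z0)"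
        using holomorphic_derivI[OF \<phi>(1) open_A z0_in_A] \<phi>(3) by simp
      have "(\<Psi> \<circ> \<phi> has_field_derivative deriv \<Psi> 0 * 1) (at z0)"
        by (rule DERIV_chain[OF d\<Psi> d\<phi>])
      then have "((\<lambda>z. z) has_field_derivative deriv \<Psi> 0 * 1) (at z0)"
        by (rule has_field_derivative_transform_within_open[OF _ open_A z0_in_A]) (simp add: \<Psi>(2))
      then have "deriv \<Psi> 0 = 1"
        using DERIV_unique[OF _ DERIV_ident] by simp
      with d\<Psi> \<phi>(2) show ?thesis by simp
    qed
    have derF: "(F has_field_derivative deriv (g n) z0) (at 0)"
    proof -
      have dg: "(g n has_field_derivative deriv (g n) z0) (at (\<Psi> 0))"
        using holomorphic_derivI[OF g(1) U(1)] z0_in_A U(2) \<Psi>0 by auto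
      have d\<phi>: "(\<phi> has_field_derivative 1) (at ((g n \<circ> \<Psi>) 0))"
        using holomorphic_derivI[OF \<phi>(1) open_A z0_in_A] \<phi>(3) \<Psi>0 g(2) by simp
      have "(\<phi> \<circ> (g n \<circ> \<Psi>) has_field_derivative 1 * (deriv (g n) z0 * 1)) (at 0)"
        by (rule DERIV_chain[OF d\<phi> DERIV_chain[OF dg der\<Psi>]])
      then show ?thesis by (simp add: F_def[abs_def] o_def)
    qed
    have "deriv H 0 = 1"
    proof -
      have "(H has_field_derivative (deriv (g n) z0 - \<rho> * 1) / \<epsilon> n) (at 0)"
        unfolding H_def by (intro DERIV_cdivide DERIV_diff derF DERIV_cmult DERIV_ident)
      then show ?thesis using \<epsilon>0[of n] by (simp add: DERIV_imp_deriv \<epsilon>_def)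
    qed
    moreover have "Re (- \<epsilon> n / \<rho>) \<ge> c * norm (\<epsilon> n)"
    proof -
      have "1 - deriv (g n) z0 / \<rho> = - \<epsilon> n / \<rho>"
        using multiplier_nz by (simp add: \<epsilon>_def field_simps)
      then show ?thesis using c(2)[of n] by (simp add: norm_divide norm_multiplier)
    qed
    ultimately have blk: "(\<forall>j\<le>N. norm ((F ^^ j) w) < r2) \<and> norm ((F ^^ N) w) \<le> r1" if "norm w \<le> r1" for w
      using N(3)[of H "\<epsilon> n" w] H_hol H_le elim(1) that unfolding F_eq by blast
    have orbit: "norm ((F ^^ j) w) < r2" if "norm w \<le> r1" for w j
      by (rule iterate_block_bound[OF N(1) blk that])
    have iter: "(g n ^^ j) (\<Psi> w) = \<Psi> ((F ^^ j) w)" if "norm w \<le> r1" for w j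
      by (induction j) (use F_conj orbit[OF that] in auto)
    have in_K2: "(g n ^^ j) z \<in> K2" if "z \<in> \<Psi> ` ball 0 r1" for z j
      using that iter orbit \<Psi>K2 by auto
    have ball_D: "ball 0 r1 \<subseteq> \<phi> ` A" using disc r by auto
    have W_eq: "\<Psi> ` ball 0 r1 = A \<inter> \<phi> -` ball 0 r1"
    proof
      show "\<Psi> ` ball 0 r1 \<subseteq> A \<inter> \<phi> -` ball 0 r1"
        using \<Psi>A ball_D by auto
      show "A \<inter> \<phi> -` ball 0 r1 \<subseteq> \<Psi> ` ball 0 r1"
        using \<Psi>(2) by (metis IntE image_eqI subsetI vimageE)
    qed
    have "\<Psi> ` ball 0 r1 \<subseteq> fatou_set (g n) U"
    proof (rule bounded_imp_subset_fatou_set[OF g(1)])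
      show "open (\<Psi> ` ball 0 r1)"
        unfolding W_eq by (intro continuous_open_preimage cont\<phi> open_A open_ball)
      show "(g n ^^ j) z \<in> U" if "z \<in> \<Psi> ` ball 0 r1" for z j
        using in_K2[OF that] K2U by blast
      obtain B' where "\<And>z. z \<in> K2 \<Longrightarrow> norm z \<le> B'"
        using compact_imp_bounded[OF K2(1)] by (auto simp: bounded_iff)
      then show "bounded_on_compacts (range (\<lambda>j. g n ^^ j)) (\<Psi> ` ball 0 r1)"
        unfolding bounded_on_compacts_def using in_K2 by (intro allI impI exI[of _ B']) blast
    qed
    moreover have "connected (\<Psi> ` ball 0 r1)"
      using \<Psi>(1) ball_D
      by (intro connected_continuous_image) (auto intro: continuous_on_subset[OF holomorphic_on_imp_continuous_on])
    moreover have "z0 \<in> \<Psi> ` ball 0 r1"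
      using \<Psi>0 r(1) by (intro image_eqI[of _ _ 0]) auto
    ultimately have "\<Psi> ` ball 0 r1 \<subseteq> immediate_basin z0 (g n) U"
      by (intro subset_immediate_basin)
    moreover have "K \<subseteq> \<Psi> ` ball 0 r1"
      unfolding W_eq using K(2) w0(2) r(2) by fastforce
    ultimately show ?case by blast
  qed
qed

end


section \<open>Siegel disks and the kernel of the basins\<close>

text \<open>
  The image of the component is connected and contains \<open>z0\<close>, so it remains to see that it lies in the Fatou
  set: being open by the open mapping theorem, it inherits bounded orbits from the component.
\<close>

lemma immediate_basin_invariant:
  assumes f: "f holomorphic_on U" and z0: "f z0 = z0" "z0 \<in> fatou_set f U"
    and nc: "\<not> f constant_on immediate_basin z0 f U"
  shows "f ` immediate_basin z0 f U \<subseteq> immediate_basin z0 f U"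
proof -
  let ?A = "immediate_basin z0 f U"
  note A = immediate_basin_basics[OF z0(2)]
  have "z \<in> U" if "z \<in> ?A" for z using A(5)[OF that, of 0] by simp
  then have hol: "f holomorphic_on ?A" using f by (auto intro: holomorphic_on_subset)
  have open_image: "open (f ` V)" if "open V" "V \<subseteq> ?A" for V
    by (rule open_mapping_thm[OF hol A(1,2) that nc])
  have "f ` ?A \<subseteq> fatou_set f U"
  proof (rule bounded_imp_subset_fatou_set[OF f])
    show "open (f ` ?A)" by (rule open_image[OF A(1) order.refl])
    show "(f ^^ n) w \<in> U" if "w \<in> f ` ?A" for w n
    proof -
      obtain z where z: "z \<in> ?A" "w = f z" using \<open>w \<in> f ` ?A\<close> by blast
      show ?thesis using A(5)[OF z(1), of "Suc n"] z(2) by (simp add: funpow_swap1)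
    qed
    show "bounded_on_compacts (range (\<lambda>n. f ^^ n)) (f ` ?A)"
    proof (rule bounded_on_compactsI)
      fix w assume "w \<in> f ` ?A"
      then obtain z where z: "z \<in> ?A" "w = f z" by blast
      obtain d where d: "d > 0" "cball z d \<subseteq> ?A"
        using open_contains_cball[THEN iffD1, OF A(1)] z(1) by blast
      have sub: "ball z d \<subseteq> ?A" using d(2) ball_subset_cball by blast
      obtain B where B: "\<And>h y. h \<in> range (\<lambda>n. f ^^ n) \<Longrightarrow> y \<in> cball z d \<Longrightarrow> norm (h y) \<le> B"
        by (rule bounded_on_compactsE[OF immediate_basin_bounded[of z0 f, OF z0(2,1) f] compact_cball d(2)]) (rule that)
      obtain e where e: "e > 0" "ball w e \<subseteq> f ` ball z d"
        using open_contains_ball[THEN iffD1, OF open_image[OF open_ball sub]] z(2) d(1)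
        by (meson centre_in_ball imageI)
      have "norm ((f ^^ n) y) \<le> B" if y: "y \<in> ball w e" for n y
      proof -
        obtain x where x: "x \<in> ball z d" "y = f x" using e(2) y by blast
        have "(f ^^ n) y = (f ^^ Suc n) x" using x(2) by (simp add: funpow_swap1)
        then show ?thesis using B[of "f ^^ Suc n" x] x(1) by (metis ball_subset_cball rangeI subsetD)
      qed
      then show "\<exists>e>0. \<exists>B. \<forall>h\<in>range (\<lambda>n. f ^^ n). \<forall>y\<in>ball w e \<inter> f ` ?A. norm (h y) \<le> B"
        using e(1) by (intro exI[of _ e] conjI exI[of _ B]) auto
    qed
  qed
  moreover have "connected (f ` ?A)"
    using A(2) hol by (intro connected_continuous_image holomorphic_on_imp_continuous_on)
  moreover have "z0 \<in> f ` ?A" using A(3) z0(1) by (metis imageI)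
  ultimately show ?thesis by (intro subset_immediate_basin)
qed

lemma irrational_multiplier_not_root_of_unity:
  assumes "irrationally_neutral_fixpoint f U z0" "k \<ge> 1"
  shows "deriv f z0 ^ k \<noteq> 1"
proof
  assume "deriv f z0 ^ k = 1"
  then have "deriv f z0 \<in> {exp (2 * of_real pi * \<i> * of_nat j / of_nat k) | j. j < k}"
    using complex_roots_unity[OF assms(2)] by blast
  then obtain j where "deriv f z0 = exp (2 * of_real pi * \<i> * of_nat j / of_nat k)" by blast
  then have "deriv f z0 = exp (2 * of_real pi * \<i> * of_real (real j / real k))" by simp
  moreover have "real j / real k \<in> \<rat>" by simp
  ultimately show False
    using assms(1) unfolding irrationally_neutral_fixpoint_def by blast
qed

lemma siegel_disc_rotation_domain:
  assumes "open U" "f holomorphic_on U" "siegel_point f U z0"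
  shows "rotation_domain f (immediate_basin z0 f U) z0 (deriv f z0)"
proof -
  have irr: "irrationally_neutral_fixpoint f U z0" and fatou: "z0 \<in> fatou_set f U"
    using assms(3) unfolding siegel_point_def by auto
  then have z0: "z0 \<in> U" "f z0 = z0" "norm (deriv f z0) = 1"
    unfolding irrationally_neutral_fixpoint_def neutral_fixpoint_def by auto
  note A = immediate_basin_basics[OF fatou]
  have AU: "immediate_basin z0 f U \<subseteq> U"
    using A(5)[of _ 0] by auto
  have nc: "\<not> f constant_on immediate_basin z0 f U"
    by (rule not_constant_on_deriv[OF holomorphic_derivI[OF assms(2,1) z0(1)] _ A(1,3)]) (use z0(3) in auto)
  show ?thesis
  proof
    show "open (immediate_basin z0 f U)" "connected (immediate_basin z0 f U)"
      "z0 \<in> immediate_basin z0 f U" by (fact A)+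
    show "f holomorphic_on immediate_basin z0 f U"
      using assms(2) AU by (rule holomorphic_on_subset)
    show "f ` immediate_basin z0 f U \<subseteq> immediate_basin z0 f U"
      by (rule immediate_basin_invariant[where f = f, OF assms(2) z0(2) fatou nc])
    show "bounded_on_compacts (range (\<lambda>n. f ^^ n)) (immediate_basin z0 f U)"
      by (rule immediate_basin_bounded[of z0 f, OF fatou z0(2) assms(2)])
    show "deriv f z0 ^ k \<noteq> 1" if "1 \<le> k" for k
      by (rule irrational_multiplier_not_root_of_unity[OF irr that])
  qed (use z0 in auto)
qed

lemma Re_ge_of_Arg_less:
  assumes "\<bar>Arg z\<bar> < \<Theta>" "\<Theta> < pi / 2"
  shows "Re z \<ge> cos \<Theta> * norm z"
proof (cases "z = 0")
  case False
  have "cos \<Theta> \<le> cos \<bar>Arg z\<bar>"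
    using assms pi_gt_zero by (intro cos_monotone_0_pi_le) auto
  also have "\<dots> = Re z / norm z"
    using cos_Arg[OF False] by (simp add: abs_if)
  finally show ?thesis using False by (simp add: field_simps)
qed simp

theorem theorem1:
  fixes U :: "complex set" and z0 :: complex and \<Theta> :: real
    and f0 :: "complex \<Rightarrow> complex" and f :: "nat \<Rightarrow> complex \<Rightarrow> complex"
  assumes "plane_domain U"
    and "f0 analytic_on U"
    and "siegel_point f0 U z0"
    and "\<And>n. f n analytic_on U"
    and "\<And>n. attracting_fixpoint (f n) U z0"
    and "\<And>K. compact K \<Longrightarrow> K \<subseteq> U \<Longrightarrow> uniform_limit K f f0 sequentially"
    and "\<Theta> < pi / 2"
    and "\<And>n. \<bar>Arg (1 - deriv (f n) z0 / deriv f0 z0)\<bar> < \<Theta>"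
    and "\<And>K. compact K \<Longrightarrow> K \<subseteq> U \<Longrightarrow>
           \<exists>M. \<forall>n. \<forall>z\<in>K. norm ((f n z - f0 z) / (deriv (f n) z0 - deriv f0 z0)) \<le> M"
  shows "kernel_converges z0 (\<lambda>n. immediate_basin z0 (f n) U) (immediate_basin z0 f0 U)"
proof -
  have U: "open U" using assms(1) unfolding plane_domain_def by blast
  have f0: "f0 holomorphic_on U" using assms(2) by (rule analytic_imp_holomorphic)
  have f: "f n holomorphic_on U" for n using assms(4) by (rule analytic_imp_holomorphic)
  have fatou: "z0 \<in> fatou_set f0 U" using assms(3) unfolding siegel_point_def by blast
  interpret R: rotation_domain f0 "immediate_basin z0 f0 U" z0 "deriv f0 z0"
    by (rule siegel_disc_rotation_domain[OF U f0 assms(3)])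
  note A0 = immediate_basin_basics[OF fatou]
  note An = immediate_basin_basics[OF attracting_fixpoint_in_fatou_set[OF U f assms(5)]]
  have domain_A0: "plane_domain (immediate_basin z0 f0 U)"
    using A0 unfolding plane_domain_def by blast
  have domain_An: "plane_domain (immediate_basin z0 (f n) U)" for n
    using An(1-3)[of n] unfolding plane_domain_def by blast
  have covers: "\<forall>\<^sub>F n in sequentially. K \<subseteq> immediate_basin z0 (f n) U"
    if K: "compact K" "K \<subseteq> immediate_basin z0 f0 U" for K
  proof (rule R.perturbation_basin_covers[OF U _ f _ assms(6) _ _ _ assms(9) K])
    show "immediate_basin z0 f0 U \<subseteq> U" using A0(5)[of _ 0] by auto
    show "f n z0 = z0" "deriv (f n) z0 \<noteq> deriv f0 z0" for n
      using assms(5)[of n] R.norm_multiplier unfolding attracting_fixpoint_def by auto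
    have "\<Theta> > 0" using assms(8)[of 0] abs_ge_zero order.strict_trans1 by blast
    then show "cos \<Theta> > 0" using assms(7) by (intro cos_gt_zero) auto
    show "cos \<Theta> * norm (1 - deriv (f n) z0 / deriv f0 z0) \<le> Re (1 - deriv (f n) z0 / deriv f0 z0)" for n
      by (rule Re_ge_of_Arg_less[OF assms(8,7)])
  qed
  show ?thesis
    unfolding kernel_converges_def
  proof (intro conjI allI impI)
    show "plane_domain (immediate_basin z0 (f n) U)" "z0 \<in> immediate_basin z0 (f n) U" for n
      using domain_An An(3) by auto
    fix r :: "nat \<Rightarrow> nat" assume r: "strict_mono r"
    show "is_kernel z0 ((\<lambda>n. immediate_basin z0 (f n) U) \<circ> r) (immediate_basin z0 f0 U)"
      unfolding is_kernel_def
    proof (intro conjI allI impI domain_A0 A0(3))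
      show "eventually_covers_compacts ((\<lambda>n. immediate_basin z0 (f n) U) \<circ> r) (immediate_basin z0 f0 U)"
        unfolding eventually_covers_compacts_def
        using eventually_subseq[OF r] covers by (auto simp: o_def)
      fix C
      assume C: "plane_domain C \<and> z0 \<in> C \<and>
        eventually_covers_compacts ((\<lambda>n. immediate_basin z0 (f n) U) \<circ> r) C"
      have "C \<subseteq> fatou_set f0 U"
      proof (rule kernel_subset_fatou_set[where f = "\<lambda>n. f (r n)", OF U f0 f _ R.fixpoint fatou
            R.multiplier_nz R.irrational assms(5)])
        show "uniform_limit K (\<lambda>n. f (r n)) f0 sequentially" if "compact K" "K \<subseteq> U" for K
          by (rule filterlim_compose[OF assms(6)[OF that] filterlim_subseq[OF r]])
      qed (use C in \<open>auto simp: plane_domain_def o_def\<close>)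
      then show "C \<subseteq> immediate_basin z0 f0 U"
        using C by (intro subset_immediate_basin) (auto simp: plane_domain_def)
    qed
  qed
qed

end
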